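(* Let $K$ be a finite simplicial complex with a position function $v:K_0\to\mathbb{R}^d$, let $F:\mathcal{D}\to\mathcal{B}$ be a feature map into a separable real Banach space with a labeled decomposition $\hat F:\hat{\mathcal{D}}_K\to\mathcal{B}^{S(K)}$, and let $X:(\Omega,\mathcal{F},P)\to\mathbb{R}^m$ be a Borel random variable on a probability space. Let $V:(\Omega,\mathcal{F},P)\to\mathcal{B}^S$ be any one of the three random variables $\eta_{S(K)}\circ X$ (with $S=S(K)$), $\eta_K\circ X$ (with $S=K$), or $\eta_{\mathcal{C}}\circ X$ (with $S=\mathcal{C}$), where $\eta_{S(K)}=\hat F\circ\hat\alpha$, $\eta_K=\bar F\circ\hat\alpha$, $\eta_{\mathcal{C}}=\tilde F\circ\hat\alpha$ are the maps defined in the context. Let $(V_k)_{k\in\mathbb{N}}$ be a sequence of independent copies of $V$ and for $n\ge1$ let $S_n=\sum_{k=1}^nV_k$. If $E[\|V\|]<\infty$, then the sequence $(\frac1nS_n)$ of $\mathcal{B}^S$-valued random variables converges to $E[V]$ almost surely.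
   Context: Chains. $K$ is a finite abstract simplicial complex: a collection of nonempty subsets of a finite set, closed under taking nonempty subsets and containing all singletons; $K_i$ is the set of simplices of cardinality $i+1$. $S(K)$ is the $\mathbb{Z}/2$-vector space with basis $K$; its elements (chains) are identified with subsets of $K$, and $\|\gamma\|_1$ is the number of simplices in $\gamma$. Persistence. For a total order $\le$ on $K$ extending inclusion $\subseteq$ (a linear extension), the boundary matrix $D$ over $\mathbb{Z}/2$ has rows and columns indexed by $K$ in the order $\le$, with $D_{\sigma\tau}=1$ iff $\sigma\subset\tau$ and $|\sigma|=|\tau|-1$. A matrix $R$ is reduced if distinct nonzero columns have different largest row indices of nonzero entries. A persistence algorithm $\mathcal{A}$ assigns to each boundary matrix $D$ a decomposition $R=DV'$ with $R$ reduced and $V'$ upper triangular with ones on the diagonal. A birth-death pair is a pair $(\sigma,\tau)$ such that $\sigma$ is the largest row index of a nonzero entry in column $\tau$ of $R$. Each birth-death pair has four associated chains: the birth simplex $\sigma$, the death simplex $\tau$, the representative cycle (sum of all $\rho$ with $R_{\rho\tau}\ne0$) and the bounding chain (sum of all $\kappa$ with $V'_{\kappa\tau}\neq0$). Fix one of these four kinds of chain as the label of birth-death pairs. Diagrams. $\mathcal{D}$ is the set of persistence diagrams, i.e. finite formal sums (multisets) $\sum_i(b_i,d_i)$ with $b_i\le d_i$ real. A labeled persistence diagram is a finite formal sum $\sum_i(b_i,d_i,\ell_i)$ with $b_i\le d_i$; $\hat{\mathcal{D}}_K$ is the set of those arising from $K$, including the empty one $0$, with labels in $S(K)$. $\varphi$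 is the map forgetting labels. Weights. A weight on $K$ is a function $w:K\to\mathbb{R}$ with $w(\sigma)\le w(\tau)$ whenever $\sigma\subseteq\tau$; $W\subseteq\mathbb{R}^K$ is the set of weights. Fix a persistence algorithm $\mathcal{A}$ and a linear extension $\trianglelefteq$ of $\subseteq$. For $w\in W$, order $K$ by: $\sigma\le_w\tau$ iff $w(\sigma)<w(\tau)$, or $w(\sigma)=w(\tau)$ and $\sigma\trianglelefteq\tau$. Then $\hat\alpha(w)=\sum(w(\sigma),w(\tau),\gamma)$, summed over birth-death pairs $(\sigma,\tau)$ obtained by applying $\mathcal{A}$ to $(K,\le_w)$, where $\gamma$ is the label of the pair. Fix $A\subseteq\mathbb{R}^m$ and $\psi:A\to W$; define $\hat\alpha:\mathbb{R}^m\to\hat{\mathcal{D}}_K$ by $\hat\alpha(a)=\hat\alpha(\psi(a))$ for $a\in A$ and $\hat\alpha(a)=0$ (empty diagram) for $a\notin A$. Feature maps. $\mathcal{B}$ is a separable real Banach space; for a finite set $S$, $\mathcal{B}^S$ has norm $\|x\|=\sum_{s\in S}\|x_s\|$. A feature map is a function $F:\mathcal{D}\to\mathcal{B}$. A labeled decomposition of $F$ is a map $\hat F=(\hat F_\gamma)_{\gamma\in S(K)}:\hat{\mathcal{D}}_K\to\mathcal{B}^{S(K)}$ with $\sum_{\gamma\in S(K)}\hat F_\gamma(\hat a)=F(\varphi(\hat a))$ for all $\hat a\in\hat{\mathcal{D}}_K$. The simplex distribution is $\bar F:\hat{\mathcal{D}}_K\to\mathcal{B}^K$, $\bar F_\sigma(\hat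 a)=\sum_{\gamma\ni\sigma}\hat F_\gamma(\hat a)/\|\gamma\|_1$ (sum over chains containing $\sigma$). For the position function $v:K_0\to\mathbb{R}^d$ ($d\ge1$), $|\sigma|$ is the convex hull of $v(\sigma)$, $d_\sigma$ is the dimension of $|\sigma|$, and $|K|=\bigcup_\sigma|\sigma|$. Given a partition of $\mathbb{R}^d$ into translates of a half-open cube $[0,s)^d$ ($s>0$), $\mathcal{C}$ is the finite set of translates that meet $|K|$. The pixel/voxel distribution is $\tilde F:\hat{\mathcal{D}}_K\to\mathcal{B}^{\mathcal{C}}$, $\tilde F_c(\hat a)=\sum_{\sigma\in K}\frac{\operatorname{vol}_{d_\sigma}(|\sigma|\cap c)}{\operatorname{vol}_{d_\sigma}(|\sigma|)}\bar F_\sigma(\hat a)$, where $\operatorname{vol}_k$ is $k$-dimensional volume ($\operatorname{vol}_0$ is counting). Standing convention: the maps $\eta_{S(K)},\eta_K,\eta_{\mathcal{C}}$ are Borel measurable. $E[V]$ denotes the Pettis integral, which exists when $E[\|V\|]<\infty$. *)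

theory Defs
  imports "HOL-Probability.Probability" "HOL-Library.Z2"
begin

section \<open>Simplicial complexes and persistence\<close>

definition abstract_simplicial_complex :: "'v set \<Rightarrow> 'v set set \<Rightarrow> bool" where
  "abstract_simplicial_complex V0 K \<longleftrightarrow>
     finite V0 \<and> K \<subseteq> Pow V0 \<and> {} \<notin> K \<and>
     (\<forall>\<tau>\<in>K. \<forall>\<sigma>. \<sigma> \<subseteq> \<tau> \<and> \<sigma> \<noteq> {} \<longrightarrow> \<sigma> \<in> K) \<and>
     (\<forall>x\<in>V0. {x} \<in> K)"

text \<open>Chains are identified with subsets of \<open>K\<close>, so that the set \<open>S(K)\<close> is \<open>Pow K\<close> and
  the norm of a chain is its cardinality.\<close>

type_synonym 'v chain = "'v set set"

definition linear_extension :: "'v set set \<Rightarrow> 'v set rel \<Rightarrow> bool" where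
  "linear_extension K le \<longleftrightarrow>
     linear_order_on K le \<and> (\<forall>\<sigma>\<in>K. \<forall>\<tau>\<in>K. \<sigma> \<subseteq> \<tau> \<longrightarrow> (\<sigma>, \<tau>) \<in> le)"

text \<open>Matrices over the field with two elements, with rows and columns indexed by simplices. A
  matrix whose rows and columns are \<^emph>\<open>ordered\<close> is given by the linear order on \<open>K\<close> together with
  the entries.\<close>

type_synonym 'v smatrix = "'v set \<Rightarrow> 'v set \<Rightarrow> bit"

definition boundary_matrix :: "'v set set \<Rightarrow> 'v smatrix" where
  "boundary_matrix K \<sigma> \<tau> =
     (if \<sigma> \<in> K \<and> \<tau> \<in> K \<and> \<sigma> \<subset> \<tau> \<and> card \<sigma> + 1 = card \<tau> then 1 else 0)"

definition is_lowest :: "'v set set \<Rightarrow> 'v set rel \<Rightarrow> 'v smatrix \<Rightarrow> 'v set \<Rightarrow> 'v set \<Rightarrow> bool" where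
  "is_lowest K le R \<tau> \<sigma> \<longleftrightarrow>
     \<sigma> \<in> K \<and> R \<sigma> \<tau> \<noteq> 0 \<and> (\<forall>\<rho>\<in>K. R \<rho> \<tau> \<noteq> 0 \<longrightarrow> (\<rho>, \<sigma>) \<in> le)"

definition reduced :: "'v set set \<Rightarrow> 'v set rel \<Rightarrow> 'v smatrix \<Rightarrow> bool" where
  "reduced K le R \<longleftrightarrow>
     (\<forall>\<tau>\<in>K. \<forall>\<tau>'\<in>K. \<forall>\<sigma> \<sigma>'.
        \<tau> \<noteq> \<tau>' \<and> is_lowest K le R \<tau> \<sigma> \<and> is_lowest K le R \<tau>' \<sigma>' \<longrightarrow> \<sigma> \<noteq> \<sigma>')"

definition unit_upper_triangular :: "'v set set \<Rightarrow> 'v set rel \<Rightarrow> 'v smatrix \<Rightarrow> bool" where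
  "unit_upper_triangular K le U \<longleftrightarrow>
     (\<forall>\<tau>\<in>K. U \<tau> \<tau> = 1) \<and> (\<forall>\<kappa>\<in>K. \<forall>\<tau>\<in>K. U \<kappa> \<tau> \<noteq> 0 \<longrightarrow> (\<kappa>, \<tau>) \<in> le)"

definition persistence_decomposition ::
  "'v set set \<Rightarrow> 'v set rel \<Rightarrow> 'v smatrix \<Rightarrow> 'v smatrix \<Rightarrow> 'v smatrix \<Rightarrow> bool" where
  "persistence_decomposition K le D R U \<longleftrightarrow>
     (\<forall>\<sigma>\<in>K. \<forall>\<tau>\<in>K. R \<sigma> \<tau> = (\<Sum>\<kappa>\<in>K. D \<sigma> \<kappa> * U \<kappa> \<tau>)) \<and>
     reduced K le R \<and> unit_upper_triangular K le U"

text \<open>An algorithm maps an ordered matrix to a pair of matrices \<open>(R, V')\<close>.\<close>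

type_synonym 'v algorithm = "'v set rel \<Rightarrow> 'v smatrix \<Rightarrow> 'v smatrix \<times> 'v smatrix"

definition persistence_algorithm :: "'v algorithm \<Rightarrow> bool" where
  "persistence_algorithm alg \<longleftrightarrow>
     (\<forall>V0 K le. abstract_simplicial_complex V0 K \<and> linear_extension K le \<longrightarrow>
        (case alg le (boundary_matrix K) of (R, U) \<Rightarrow>
           persistence_decomposition K le (boundary_matrix K) R U))"

definition birth_death_pairs ::
  "'v set set \<Rightarrow> 'v algorithm \<Rightarrow> 'v set rel \<Rightarrow> ('v set \<times> 'v set) set" where
  "birth_death_pairs K alg le =
     {(\<sigma>, \<tau>). \<tau> \<in> K \<and> is_lowest K le (fst (alg le (boundary_matrix K))) \<tau> \<sigma>}"

datatype label_kind = Birth_Simplex | Death_Simplex | Representative_Cycle | Bounding_Chain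

definition pair_label ::
  "'v set set \<Rightarrow> 'v algorithm \<Rightarrow> label_kind \<Rightarrow> 'v set rel \<Rightarrow> 'v set \<times> 'v set \<Rightarrow> 'v chain" where
  "pair_label K alg kind le = (\<lambda>(\<sigma>, \<tau>). case kind of
       Birth_Simplex \<Rightarrow> {\<sigma>}
     | Death_Simplex \<Rightarrow> {\<tau>}
     | Representative_Cycle \<Rightarrow> {\<rho>\<in>K. fst (alg le (boundary_matrix K)) \<rho> \<tau> \<noteq> 0}
     | Bounding_Chain \<Rightarrow> {\<kappa>\<in>K. snd (alg le (boundary_matrix K)) \<kappa> \<tau> \<noteq> 0})"


section \<open>Labeled persistence diagrams\<close>

type_synonym diagram = "(real \<times> real) multiset"
type_synonym 'v labeled_diagram = "(real \<times> real \<times> 'v chain) multiset"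

definition forget_labels :: "'v labeled_diagram \<Rightarrow> diagram" where
  "forget_labels = image_mset (\<lambda>(b, d, l). (b, d))"

text \<open>Only the values of a weight on \<open>K\<close> matter.\<close>

definition weights :: "'v set set \<Rightarrow> ('v set \<Rightarrow> real) set" where
  "weights K = {w. \<forall>\<sigma>\<in>K. \<forall>\<tau>\<in>K. \<sigma> \<subseteq> \<tau> \<longrightarrow> w \<sigma> \<le> w \<tau>}"

definition weight_order :: "'v set set \<Rightarrow> 'v set rel \<Rightarrow> ('v set \<Rightarrow> real) \<Rightarrow> 'v set rel" where
  "weight_order K ext w =
     {(\<sigma>, \<tau>) \<in> K \<times> K. w \<sigma> < w \<tau> \<or> w \<sigma> = w \<tau> \<and> (\<sigma>, \<tau>) \<in> ext}"

definition weight_diagram ::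
  "'v set set \<Rightarrow> 'v set rel \<Rightarrow> 'v algorithm \<Rightarrow> label_kind \<Rightarrow> ('v set \<Rightarrow> real) \<Rightarrow> 'v labeled_diagram"
  where
  "weight_diagram K ext alg kind w =
     (let le = weight_order K ext w in
      {# (w \<sigma>, w \<tau>, pair_label K alg kind le (\<sigma>, \<tau>)).
           (\<sigma>, \<tau>) \<in># mset_set (birth_death_pairs K alg le) #})"

text \<open>The labeled persistence diagrams arising from \<open>K\<close>, including the empty one.\<close>

definition labeled_diagrams ::
  "'v set set \<Rightarrow> 'v set rel \<Rightarrow> 'v algorithm \<Rightarrow> label_kind \<Rightarrow> 'v labeled_diagram set" where
  "labeled_diagrams K ext alg kind = insert {#} (weight_diagram K ext alg kind ` weights K)"

definition alpha_hat ::
  "'v set set \<Rightarrow> 'v set rel \<Rightarrow> 'v algorithm \<Rightarrow> label_kind \<Rightarrow>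
   'x set \<Rightarrow> ('x \<Rightarrow> 'v set \<Rightarrow> real) \<Rightarrow> 'x \<Rightarrow> 'v labeled_diagram" where
  "alpha_hat K ext alg kind A \<psi> a =
     (if a \<in> A then weight_diagram K ext alg kind (\<psi> a) else {#})"


section \<open>Finite powers of a Banach space\<close>

text \<open>The space of \<open>S\<close>-indexed families in \<open>\<B>\<close> is modelled by functions that are extensional on
  \<open>S\<close>; it carries the sum norm and the Borel sigma-algebra of the topology of that norm.\<close>

definition bpow :: "'s set \<Rightarrow> ('s \<Rightarrow> 'b::real_normed_vector) set" where
  "bpow S = S \<rightarrow>\<^sub>E UNIV"

definition bpow_norm :: "'s set \<Rightarrow> ('s \<Rightarrow> 'b::real_normed_vector) \<Rightarrow> real" where
  "bpow_norm S x = (\<Sum>s\<in>S. norm (x s))"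

definition bpow_topology :: "'s set \<Rightarrow> ('s \<Rightarrow> 'b::real_normed_vector) topology" where
  "bpow_topology S = Metric_space.mtopology (bpow S) (\<lambda>x y. bpow_norm S (\<lambda>s. x s - y s))"

definition bpow_borel :: "'s set \<Rightarrow> ('s \<Rightarrow> 'b::real_normed_vector) measure" where
  "bpow_borel S = sigma (bpow S) {U. openin (bpow_topology S) U}"

definition bpow_functional :: "'s set \<Rightarrow> (('s \<Rightarrow> 'b::real_normed_vector) \<Rightarrow> real) \<Rightarrow> bool" where
  "bpow_functional S f \<longleftrightarrow>
     (\<forall>x\<in>bpow S. \<forall>y\<in>bpow S. f (\<lambda>s\<in>S. x s + y s) = f x + f y) \<and>
     (\<forall>c. \<forall>x\<in>bpow S. f (\<lambda>s\<in>S. c *\<^sub>R x s) = c * f x) \<and>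
     (\<exists>C. \<forall>x\<in>bpow S. \<bar>f x\<bar> \<le> C * bpow_norm S x)"

definition has_pettis_integral ::
  "'w measure \<Rightarrow> 's set \<Rightarrow> ('w \<Rightarrow> 's \<Rightarrow> 'b::real_normed_vector) \<Rightarrow> ('s \<Rightarrow> 'b) \<Rightarrow> bool" where
  "has_pettis_integral M S V e \<longleftrightarrow>
     e \<in> bpow S \<and>
     (\<forall>f. bpow_functional S f \<longrightarrow>
        integrable M (\<lambda>\<omega>. f (V \<omega>)) \<and> f e = (\<integral>\<omega>. f (V \<omega>) \<partial>M))"

definition pettis_integral ::
  "'w measure \<Rightarrow> 's set \<Rightarrow> ('w \<Rightarrow> 's \<Rightarrow> 'b::real_normed_vector) \<Rightarrow> 's \<Rightarrow> 'b" where
  "pettis_integral M S V = (THE e. has_pettis_integral M S V e)"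

text \<open>The copies of \<open>V\<close> may live on a probability space \<open>N\<close> other than the domain \<open>M\<close> of \<open>V\<close>,
  which need not support any independent copies.\<close>

definition independent_copies ::
  "'w measure \<Rightarrow> 's set \<Rightarrow> ('w \<Rightarrow> 's \<Rightarrow> 'b::real_normed_vector) \<Rightarrow>
   'u measure \<Rightarrow> (nat \<Rightarrow> 'u \<Rightarrow> 's \<Rightarrow> 'b) \<Rightarrow> bool" where
  "independent_copies M S V N Vs \<longleftrightarrow>
     prob_space.indep_vars N (\<lambda>_. bpow_borel S) Vs UNIV \<and>
     (\<forall>k. distr N (bpow_borel S) (Vs k) = distr M (bpow_borel S) V)"

definition sample_mean ::
  "'s set \<Rightarrow> (nat \<Rightarrow> 'u \<Rightarrow> 's \<Rightarrow> 'b::real_normed_vector) \<Rightarrow> nat \<Rightarrow> 'u \<Rightarrow> 's \<Rightarrow> 'b" where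
  "sample_mean S Vs n \<omega> = (\<lambda>s\<in>S. (1 / real n) *\<^sub>R (\<Sum>k=1..n. Vs k \<omega> s))"


section \<open>Feature maps and their distributions\<close>

definition labeled_decomposition ::
  "'v set set \<Rightarrow> 'v labeled_diagram set \<Rightarrow> (diagram \<Rightarrow> 'b::real_normed_vector) \<Rightarrow>
   ('v labeled_diagram \<Rightarrow> 'v chain \<Rightarrow> 'b) \<Rightarrow> bool" where
  "labeled_decomposition K Dh F Fh \<longleftrightarrow>
     Fh \<in> Dh \<rightarrow> bpow (Pow K) \<and>
     (\<forall>a\<in>Dh. (\<Sum>\<gamma>\<in>Pow K. Fh a \<gamma>) = F (forget_labels a))"

definition simplex_distribution ::
  "'v set set \<Rightarrow> ('v labeled_diagram \<Rightarrow> 'v chain \<Rightarrow> 'b::real_normed_vector) \<Rightarrow>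
   'v labeled_diagram \<Rightarrow> 'v set \<Rightarrow> 'b" where
  "simplex_distribution K Fh a =
     (\<lambda>\<sigma>\<in>K. \<Sum>\<gamma>\<in>{\<gamma>\<in>Pow K. \<sigma> \<in> \<gamma>}. Fh a \<gamma> /\<^sub>R real (card \<gamma>))"

definition orthonormal_frame :: "nat \<Rightarrow> (nat \<Rightarrow> 'a::euclidean_space) \<Rightarrow> bool" where
  "orthonormal_frame k b \<longleftrightarrow> (\<forall>i<k. \<forall>j<k. b i \<bullet> b j = (if i = j then 1 else 0))"

definition frame_map :: "nat \<Rightarrow> 'a::euclidean_space \<Rightarrow> (nat \<Rightarrow> 'a) \<Rightarrow> (nat \<Rightarrow> real) \<Rightarrow> 'a" where
  "frame_map k p b x = p + (\<Sum>i<k. x i *\<^sub>R b i)"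

text \<open>The \<open>k\<close>-dimensional volume of a set \<open>A\<close> lying in some \<open>k\<close>-dimensional affine subspace:
  choose an isometric parametrization of such a subspace by \<open>k\<close> orthonormal coordinates and
  measure the preimage of \<open>A\<close> with the Lebesgue measure in these coordinates. For Borel sets \<open>A\<close>
  the value does not depend on the choices. As the empty product measure is the unit mass on a
  one-point space, the case \<open>k = 0\<close> (where \<open>A\<close> has at most one point) is counting.\<close>

definition flat_volume :: "nat \<Rightarrow> 'a::euclidean_space set \<Rightarrow> real" where
  "flat_volume k A =
     (let (p, b) = (SOME (p, b). orthonormal_frame k b \<and> A \<subseteq> range (frame_map k p b))
      in measure (PiM {..<k} (\<lambda>_. lborel)) {x \<in> {..<k} \<rightarrow>\<^sub>E UNIV. frame_map k p b x \<in> A})"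

definition realization :: "('v \<Rightarrow> 'a::euclidean_space) \<Rightarrow> 'v set \<Rightarrow> 'a set" where
  "realization v \<sigma> = convex hull (v ` \<sigma>)"

definition simplex_dim :: "('v \<Rightarrow> 'a::euclidean_space) \<Rightarrow> 'v set \<Rightarrow> nat" where
  "simplex_dim v \<sigma> = nat (aff_dim (realization v \<sigma>))"

definition cube_partition :: "real \<Rightarrow> (real^'d) set set \<Rightarrow> bool" where
  "cube_partition s Q \<longleftrightarrow>
     partition_on UNIV Q \<and> (\<forall>c\<in>Q. \<exists>t. c = (+) t ` {x. \<forall>i. 0 \<le> x $ i \<and> x $ i < s})"

definition voxels :: "'v set set \<Rightarrow> ('v \<Rightarrow> real^'d) \<Rightarrow> (real^'d) set set \<Rightarrow> (real^'d) set set" where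
  "voxels K v Q = {c\<in>Q. c \<inter> (\<Union>\<sigma>\<in>K. realization v \<sigma>) \<noteq> {}}"

definition voxel_distribution ::
  "'v set set \<Rightarrow> ('v \<Rightarrow> real^'d) \<Rightarrow> (real^'d) set set \<Rightarrow>
   ('v labeled_diagram \<Rightarrow> 'v chain \<Rightarrow> 'b::real_normed_vector) \<Rightarrow>
   'v labeled_diagram \<Rightarrow> (real^'d) set \<Rightarrow> 'b" where
  "voxel_distribution K v Q Fh a =
     (\<lambda>c\<in>voxels K v Q. \<Sum>\<sigma>\<in>K.
        (flat_volume (simplex_dim v \<sigma>) (realization v \<sigma> \<inter> c) /
         flat_volume (simplex_dim v \<sigma>) (realization v \<sigma>)) *\<^sub>R simplex_distribution K Fh a \<sigma>)"

end

theory Submission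
  imports Defs
begin

text \<open>The index set is finite (bounded sets meet only finitely many cubes of the partition), so the
  claim splits into coordinates: it suffices to have the strong law for i.i.d. Bochner integrable
  variables in a separable Banach space, and that the Pettis integral is the family of the
  coordinatewise Bochner integrals. For the latter, uniqueness needs enough functionals, i.e. the
  Hahn--Banach theorem. For the former, approximate \<open>Y\<close> in \<open>L\<^sup>1\<close> by \<open>h Y\<close> with \<open>h\<close>
  simple. The means of \<open>h Y\<^sub>k\<close> converge because indicators obey Hoeffding's inequality, and the
  means of the error \<open>norm (Y\<^sub>k - h Y\<^sub>k)\<close> are eventually at most twice any number above their
  small expectation.\<close>

section \<open>The Hahn--Banach theorem by minimal sublinear functionals\<close>

definition sublinear :: "('a::real_vector \<Rightarrow> real) \<Rightarrow> bool" where
  "sublinear p \<longleftrightarrow> (\<forall>x y. p (x + y) \<le> p x + p y) \<and> (\<forall>c\<ge>0. \<forall>x. p (c *\<^sub>R x) = c * p x)"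

lemma sublinear_add: "sublinear p \<Longrightarrow> p (x + y) \<le> p x + p y"
  and sublinear_scaleR: "sublinear p \<Longrightarrow> c \<ge> 0 \<Longrightarrow> p (c *\<^sub>R x) = c * p x"
  by (auto simp: sublinear_def)

lemma sublinear_zero: "sublinear p \<Longrightarrow> p 0 = 0"
  using sublinear_scaleR[of p 0 0] by simp

lemma sublinear_minus_ge: "sublinear p \<Longrightarrow> - p (- x) \<le> p x"
  using sublinear_add[of p x "- x"] sublinear_zero[of p] by simp

text \<open>For positive \<open>c\<close> the reverse inequality comes from the assumption at
  \<open>inverse c\<close> and \<open>c *\<^sub>R x\<close>. Functionals defined as infima therefore
  only need upper bounds.\<close>

lemma sublinearI:
  assumes "p 0 = 0"
    and "\<And>x y. p (x + y) \<le> p x + p y"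
    and le: "\<And>c x. c > 0 \<Longrightarrow> p (c *\<^sub>R x) \<le> c * p x"
  shows "sublinear p"
  unfolding sublinear_def
proof (intro conjI allI impI)
  fix c :: real and x assume "0 \<le> c"
  show "p (c *\<^sub>R x) = c * p x"
  proof (cases "c = 0")
    case False
    with \<open>0 \<le> c\<close> have "p (inverse c *\<^sub>R c *\<^sub>R x) \<le> inverse c * p (c *\<^sub>R x)"
      by (intro le) simp
    with \<open>0 \<le> c\<close> False have "c * p x \<le> p (c *\<^sub>R x)"
      by (simp add: field_simps)
    moreover have "p (c *\<^sub>R x) \<le> c * p x"
      using \<open>0 \<le> c\<close> False by (intro le) simp
    ultimately show ?thesis by simp
  qed (use assms in simp)
qed (use assms in auto)

text \<open>If \<open>p\<close> is minimal, the functional \<open>q\<close> provided here coincides with \<open>p\<close>, and the last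
  conclusion forces \<open>p (- y) = - p y\<close>.\<close>

lemma sublinear_tilt:
  assumes p: "sublinear p"
  obtains q where "sublinear q" "q \<le> p" "q (- y) \<le> - p y"
proof -
  \<comment> \<open>A linear \<open>f \<le> p\<close> with \<open>f y = p y\<close> satisfies
    \<open>f x \<le> g x t\<close> for every \<open>t \<ge> 0\<close>. The infimum \<open>q\<close>
    over \<open>t\<close> thus stays above all such \<open>f\<close>, while \<open>t = 0\<close>
    keeps it below \<open>p\<close>.\<close>
  define g where "g x t = p (x + t *\<^sub>R y) - t * p y" for x t
  define q where "q x = (INF t\<in>{0..}. g x t)" for x
  have lower: "- p (- x) \<le> g x t" if "t \<ge> 0" for x t
    using sublinear_add[OF p, of "x + t *\<^sub>R y" "- x"] sublinear_scaleR[OF p that]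
    by (simp add: g_def)
  have q_le: "q x \<le> g x t" if "t \<ge> 0" for x t
    unfolding q_def using that by (intro cINF_lower bdd_belowI2[where m = "- p (- x)"] lower) auto
  have q_ge: "m \<le> q x" if "\<And>t. t \<ge> 0 \<Longrightarrow> m \<le> g x t" for m x
    unfolding q_def using that by (intro cINF_greatest) auto
  have "sublinear q"
  proof (rule sublinearI)
    have "q 0 \<le> g 0 0" by (rule q_le) simp
    moreover have "- p (- 0) \<le> q 0" by (rule q_ge) (rule lower)
    ultimately show "q 0 = 0"
      by (simp add: g_def sublinear_zero[OF p])
  next
    fix x x'
    \<comment> \<open>The parameters \<open>s\<close> and \<open>t\<close> vary independently; their
      sum is the parameter used for \<open>x + x'\<close>.\<close>
    have "q (x + x') - g x s \<le> g x' t" if "s \<ge> 0" "t \<ge> 0" for s t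
      using q_le[of "s + t" "x + x'"] that
        sublinear_add[OF p, of "x + s *\<^sub>R y" "x' + t *\<^sub>R y"]
      by (simp add: g_def algebra_simps)
    then have "q (x + x') - g x s \<le> q x'" if "s \<ge> 0" for s
      using that by (intro q_ge)
    then have "q (x + x') - q x' \<le> q x"
      by (intro q_ge) (simp add: algebra_simps)
    then show "q (x + x') \<le> q x + q x'" by simp
  next
    fix c :: real and x assume "c > 0"
    have "q (c *\<^sub>R x) / c \<le> g x t" if "t \<ge> 0" for t
      using q_le[of "c * t" "c *\<^sub>R x"] that \<open>c > 0\<close>
        sublinear_scaleR[OF p, of c "x + t *\<^sub>R y"]
      by (simp add: g_def field_simps scaleR_add_right)
    then have "q (c *\<^sub>R x) / c \<le> q x" by (rule q_ge)
    with \<open>c > 0\<close> show "q (c *\<^sub>R x) \<le> c * q x"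
      by (simp add: field_simps)
  qed
  moreover have "q \<le> p"
    using q_le[of 0] by (auto simp: le_fun_def g_def)
  moreover have "q (- y) \<le> - p y"
    using q_le[of 1 "- y"] by (simp add: g_def sublinear_zero[OF p])
  ultimately show thesis by (rule that)
qed

text \<open>Subadditivity survives because of the chain condition: near-optimal choices
  \<open>p\<close> for \<open>x\<close> and \<open>q\<close> for \<open>y\<close> can both be
  replaced by the smaller of the two. This provides the bounds of chains for Zorn's lemma.\<close>

lemma sublinear_INF:
  assumes "C \<noteq> {}" and sub: "\<And>p. p \<in> C \<Longrightarrow> sublinear p"
    and bdd: "\<And>x. bdd_below ((\<lambda>p. p x) ` C)"
    and chain: "\<And>p q. p \<in> C \<Longrightarrow> q \<in> C \<Longrightarrow> p \<le> q \<or> q \<le> p"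
  shows "sublinear (\<lambda>x. INF p\<in>C. p x)"
proof (rule sublinearI)
  show "(INF p\<in>C. p 0) = 0"
    using \<open>C \<noteq> {}\<close> by (simp add: sublinear_zero[OF sub] cong: image_cong_simp)
next
  fix x y
  let ?u = "\<lambda>x. INF p\<in>C. p x"
  have "?u (x + y) - p x \<le> q y" if "p \<in> C" "q \<in> C" for p q
  proof -
    obtain r where r: "r \<in> C" "r \<le> p" "r \<le> q"
      using chain[of p q] \<open>p \<in> C\<close> \<open>q \<in> C\<close> by blast
    have "?u (x + y) \<le> r (x + y)"
      using r by (intro cINF_lower bdd)
    also have "\<dots> \<le> r x + r y"
      by (rule sublinear_add[OF sub[OF r(1)]])
    also have "\<dots> \<le> p x + q y"
      using r by (intro add_mono) (auto simp: le_fun_def)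
    finally show ?thesis by simp
  qed
  then have "?u (x + y) - p x \<le> ?u y" if "p \<in> C" for p
    using that \<open>C \<noteq> {}\<close> by (intro cINF_greatest) auto
  then have "?u (x + y) - ?u y \<le> ?u x"
    using \<open>C \<noteq> {}\<close> by (intro cINF_greatest) (auto simp: algebra_simps)
  then show "?u (x + y) \<le> ?u x + ?u y" by simp
next
  fix c :: real and x assume "c > 0"
  have "(INF p\<in>C. p (c *\<^sub>R x)) / c \<le> p x" if "p \<in> C" for p
    using cINF_lower[OF bdd that, of "c *\<^sub>R x"] sublinear_scaleR[OF sub[OF that], of c x] \<open>c > 0\<close>
    by (simp add: field_simps)
  then have "(INF p\<in>C. p (c *\<^sub>R x)) / c \<le> (INF p\<in>C. p x)"
    using \<open>C \<noteq> {}\<close> by (intro cINF_greatest)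
  with \<open>c > 0\<close> show "(INF p\<in>C. p (c *\<^sub>R x)) \<le> c * (INF p\<in>C. p x)"
    by (simp add: field_simps)
qed

text \<open>Zorn's lemma yields a minimal sublinear functional \<open>m\<close> below
  \<open>p0\<close>. By \<open>sublinear_tilt\<close> minimality makes \<open>m\<close> odd, and for
  an odd functional the sublinear inequalities turn into equations.\<close>

theorem Hahn_Banach_sublinear:
  assumes p0: "sublinear p0"
  obtains f where "linear f" "\<And>x. f x \<le> p0 x"
proof -
  let ?A = "{p. sublinear p \<and> p \<le> p0}"
  \<comment> \<open>The order is reversed, so the maximal element supplied by Zorn's lemma is a
    minimal functional.\<close>
  have "\<exists>m\<in>?A. \<forall>a\<in>?A. m \<ge> a \<longrightarrow> a = m"
  proof (rule predicate_Zorn)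
    show "partial_order_on ?A (relation_of (\<ge>) ?A)"
      by (rule partial_order_on_relation_ofI) auto
  next
    fix C assume "C \<in> Chains (relation_of (\<ge>) ?A)"
    then have C: "C \<subseteq> ?A" "\<And>p q. p \<in> C \<Longrightarrow> q \<in> C \<Longrightarrow> p \<le> q \<or> q \<le> p"
      by (auto simp: Chains_def relation_of_def)
    show "\<exists>u\<in>?A. \<forall>a\<in>C. a \<ge> u"
    proof (cases "C = {}")
      case True
      with p0 show ?thesis by auto
    next
      case False
      have bdd: "bdd_below ((\<lambda>p. p x) ` C)" for x
      proof (rule bdd_belowI2)
        fix p assume "p \<in> C"
        with C have "sublinear p" "p (- x) \<le> p0 (- x)" by (auto simp: le_fun_def)
        then show "- p0 (- x) \<le> p x"
          using sublinear_minus_ge[of p x] by linarith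
      qed
      let ?u = "\<lambda>x. INF p\<in>C. p x"
      have le: "?u \<le> p" if "p \<in> C" for p
        using that by (auto simp: le_fun_def intro!: cINF_lower bdd)
      moreover have "sublinear ?u"
        using C False by (intro sublinear_INF bdd) auto
      moreover have "?u \<le> p0"
        using False le C by (blast intro: order_trans)
      ultimately show ?thesis by blast
    qed
  qed
  then obtain m where m: "sublinear m" "m \<le> p0"
    and minimal: "\<And>q. sublinear q \<Longrightarrow> q \<le> m \<Longrightarrow> q = m"
    by (blast intro: order_trans)
  have minus: "m (- y) = - m y" for y
  proof -
    obtain q where "sublinear q" "q \<le> m" "q (- y) \<le> - m y"
      by (rule sublinear_tilt[OF m(1)])
    with minimal have "m (- y) \<le> - m y" by blast
    with sublinear_minus_ge[OF m(1), of "- y"] show ?thesis by simp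
  qed
  have "linear m"
  proof (rule linearI)
    show "m (x + y) = m x + m y" for x y
      using sublinear_add[OF m(1), of x y] sublinear_add[OF m(1), of "x + y" "- y"]
      by (simp add: minus)
    show "m (c *\<^sub>R x) = c *\<^sub>R m x" for c x
      using sublinear_scaleR[OF m(1), of "\<bar>c\<bar>" x] minus[of "c *\<^sub>R x"]
      by (cases "c \<ge> 0") simp_all
  qed
  with m(2) show thesis
    by (intro that) (auto simp: le_fun_def)
qed

text \<open>Tilting the norm at \<open>x\<close> before applying Hahn-Banach gives
  \<open>f (- x) \<le> - norm x\<close>, hence \<open>f x \<ge> norm x > 0\<close>. Domination by
  the norm makes \<open>f\<close> bounded.\<close>

corollary exists_bounded_linear_nonzero:
  fixes x :: "'a::real_normed_vector"
  assumes "x \<noteq> 0"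
  obtains f :: "'a \<Rightarrow> real" where "bounded_linear f" "f x \<noteq> 0"
proof -
  have "sublinear (norm :: 'a \<Rightarrow> real)"
    by (auto simp: sublinear_def norm_triangle_ineq)
  then obtain q :: "'a \<Rightarrow> real" where q: "sublinear q" "q \<le> norm" "q (- x) \<le> - norm x"
    by (rule sublinear_tilt)
  obtain f where f: "linear f" "\<And>y. f y \<le> q y"
    using q(1) by (rule Hahn_Banach_sublinear) blast
  have le: "f y \<le> norm y" for y
    using f(2)[of y] q(2) by (auto simp: le_fun_def intro: order_trans)
  show thesis
  proof (rule that)
    show "bounded_linear f"
    proof (intro bounded_linear_intro[where K = 1])
      show "norm (f y) \<le> norm y * 1" for y
        using le[of y] le[of "- y"] by (auto simp: linear_neg[OF f(1)])
    qed (use f in \<open>auto simp: linear_add linear_scale\<close>)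
    show "f x \<noteq> 0"
    proof -
      have "0 < norm x" using assms by simp
      also have "\<dots> \<le> f x"
        using f(2)[of "- x"] q(3) by (simp add: linear_neg[OF f(1)])
      finally show ?thesis by simp
    qed
  qed
qed


section \<open>The strong law of large numbers in Banach spaces\<close>

lemma (in prob_space) indep_vars_imp_indep_var:
  assumes "indep_vars M' X I" "i \<in> I" "j \<in> I" "i \<noteq> j"
  shows "indep_var (M' i) (X i) (M' j) (X j)"
proof -
  have "indep_var (PiM {i} M') (\<lambda>\<omega>. restrict (\<lambda>k. X k \<omega>) {i}) (PiM {j} M') (\<lambda>\<omega>. restrict (\<lambda>k. X k \<omega>) {j})"
    using assms by (intro indep_var_restrict[OF assms(1)]) auto
  then have "indep_var (M' i) ((\<lambda>f. f i) \<circ> (\<lambda>\<omega>. restrict (\<lambda>k. X k \<omega>) {i}))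
      (M' j) ((\<lambda>f. f j) \<circ> (\<lambda>\<omega>. restrict (\<lambda>k. X k \<omega>) {j}))"
    by (rule indep_var_compose) auto
  then show ?thesis by (simp add: comp_def)
qed

text \<open>Expectations of products factor for distinct indices, so all covariances off the
  diagonal vanish. What remains is the sum of the variances, each at most the second moment.\<close>

lemma (in prob_space) variance_sum_indep_vars_le:
  fixes X :: "'i \<Rightarrow> 'a \<Rightarrow> real"
  assumes "finite I" and indep: "indep_vars (\<lambda>_. borel) X I"
    and sq: "\<And>i. i \<in> I \<Longrightarrow> integrable M (\<lambda>x. (X i x)\<^sup>2)"
  shows "integrable M (\<lambda>x. (\<Sum>i\<in>I. X i x)\<^sup>2)"
    and "variance (\<lambda>x. \<Sum>i\<in>I. X i x) \<le> (\<Sum>i\<in>I. expectation (\<lambda>x. (X i x)\<^sup>2))"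
proof -
  have rv[measurable]: "random_variable borel (X i)" if "i \<in> I" for i
    using indep that by (auto simp: indep_vars_def)
  have int: "integrable M (X i)" if "i \<in> I" for i
    using rv[OF that] sq[OF that] by (rule square_integrable_imp_integrable)
  have prod: "integrable M (\<lambda>x. X i x * X j x)"
      "i \<noteq> j \<Longrightarrow> expectation (\<lambda>x. X i x * X j x) = expectation (X i) * expectation (X j)"
    if "i \<in> I" "j \<in> I" for i j
  proof -
    show "integrable M (\<lambda>x. X i x * X j x)"
    proof (cases "i = j")
      case False
      with that show ?thesis
        by (intro indep_var_integrable int indep_vars_imp_indep_var[OF indep])
    qed (use sq that in \<open>simp add: power2_eq_square\<close>)
    show "expectation (\<lambda>x. X i x * X j x) = expectation (X i) * expectation (X j)" if "i \<noteq> j"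
      using that \<open>i \<in> I\<close> \<open>j \<in> I\<close>
      by (intro indep_var_lebesgue_integral int indep_vars_imp_indep_var[OF indep])
  qed
  have square: "(\<Sum>i\<in>I. X i x)\<^sup>2 = (\<Sum>i\<in>I. \<Sum>j\<in>I. X i x * X j x)" for x
    by (simp add: power2_eq_square sum_product)
  show int_sq: "integrable M (\<lambda>x. (\<Sum>i\<in>I. X i x)\<^sup>2)"
    unfolding square using prod by auto
  have "variance (\<lambda>x. \<Sum>i\<in>I. X i x)
      = expectation (\<lambda>x. (\<Sum>i\<in>I. X i x)\<^sup>2) - (\<Sum>i\<in>I. expectation (X i))\<^sup>2"
    using int int_sq by (subst variance_eq) auto
  also have "\<dots> = (\<Sum>i\<in>I. \<Sum>j\<in>I. expectation (\<lambda>x. X i x * X j x))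
      - (\<Sum>i\<in>I. \<Sum>j\<in>I. expectation (X i) * expectation (X j))"
    unfolding square using prod by (simp add: power2_eq_square sum_product)
  also have "\<dots> = (\<Sum>i\<in>I. \<Sum>j\<in>I. expectation (\<lambda>x. X i x * X j x) - expectation (X i) * expectation (X j))"
    by (simp add: sum_subtractf)
  also have "\<dots> = (\<Sum>i\<in>I. \<Sum>j\<in>I. if j = i
      then expectation (\<lambda>x. X i x * X i x) - expectation (X i) * expectation (X i) else 0)"
    by (intro sum.cong refl) (auto simp: prod)
  also have "\<dots> = (\<Sum>i\<in>I. expectation (\<lambda>x. (X i x)\<^sup>2) - (expectation (X i))\<^sup>2)"
    using \<open>finite I\<close> by (intro sum.cong refl) (simp add: sum.delta power2_eq_square)
  also have "\<dots> \<le> (\<Sum>i\<in>I. expectation (\<lambda>x. (X i x)\<^sup>2))"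
    by (intro sum_mono) simp
  finally show "variance (\<lambda>x. \<Sum>i\<in>I. X i x) \<le> (\<Sum>i\<in>I. expectation (\<lambda>x. (X i x)\<^sup>2))" .
qed

text \<open>Telescoping with the potential \<open>min x (x\<^sup>2 / 2 ^ j)\<close>, which loses at least half of each
  summand.\<close>

lemma sum_dyadic_truncated_square_le:
  fixes x :: real
  assumes "x \<ge> 0"
  shows "(\<Sum>j<n. (if x \<le> 2 ^ j then x else 0)\<^sup>2 / 2 ^ j) \<le> 2 * x"
proof -
  define \<phi> where "\<phi> j = min x (x\<^sup>2 / 2 ^ j)" for j :: nat
  have step: "(if x \<le> 2 ^ j then x else 0)\<^sup>2 / 2 ^ j \<le> 2 * (\<phi> j - \<phi> (Suc j))" for j
  proof (cases "x \<le> 2 ^ j")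
    case True
    then have "x * x \<le> x * 2 ^ j" using assms by (intro mult_left_mono)
    then have "\<phi> j = x\<^sup>2 / 2 ^ j" "\<phi> (Suc j) \<le> x\<^sup>2 / 2 ^ j / 2"
      by (auto simp: \<phi>_def power2_eq_square field_simps)
    with True show ?thesis by (simp add: field_simps)
  next
    case False
    have "x\<^sup>2 / 2 ^ Suc j \<le> x\<^sup>2 / 2 ^ j"
      by (intro divide_left_mono) auto
    then have "\<phi> (Suc j) \<le> \<phi> j"
      unfolding \<phi>_def by (intro min.mono) auto
    with False show ?thesis by simp
  qed
  have "(\<Sum>j<n. (if x \<le> 2 ^ j then x else 0)\<^sup>2 / 2 ^ j) \<le> (\<Sum>j<n. 2 * (\<phi> j - \<phi> (Suc j)))"
    by (intro sum_mono step)
  also have "\<dots> = 2 * (\<phi> 0 - \<phi> n)"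
    unfolding sum_distrib_left[symmetric] sum_lessThan_telescope' ..
  also have "\<dots> \<le> 2 * x"
  proof -
    have "\<phi> 0 \<le> x" "0 \<le> \<phi> n" using assms by (auto simp: \<phi>_def)
    then show ?thesis by simp
  qed
  finally show ?thesis .
qed

text \<open>If the last indicator is one, the full geometric sum \<open>2 * 2 ^ n - 1\<close> is
  already below \<open>2 * x\<close>; otherwise the last summand vanishes and the induction
  hypothesis applies.\<close>

lemma sum_dyadic_indicator_le:
  fixes x :: real
  assumes "x \<ge> 0"
  shows "(\<Sum>j<n. 2 ^ j * indicator {2 ^ j<..} x) \<le> 2 * x"
proof (induction n)
  case (Suc n)
  show ?case
  proof (cases "x > 2 ^ n")
    case True
    have "(\<Sum>j<Suc n. 2 ^ j * indicator {2 ^ j<..} x) \<le> (\<Sum>j<Suc n. 2 ^ j :: real)"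
      by (intro sum_mono) (auto simp: indicator_def)
    also have "\<dots> = 2 * 2 ^ n - 1"
      by (subst sum_gp_strict) simp
    finally show ?thesis using True by simp
  qed (use Suc in simp)
qed (use assms in simp)

text \<open>Partial sums of the integrals are integrals of partial sums, hence bounded by the
  integral of \<open>f\<close>. This turns the two pointwise dyadic bounds into summable bounds on
  error probabilities.\<close>

lemma summable_integral_nonneg:
  fixes g :: "nat \<Rightarrow> 'a \<Rightarrow> real"
  assumes f: "integrable M f" and g: "\<And>n. integrable M (g n)" and nonneg: "\<And>n x. 0 \<le> g n x"
    and le: "AE x in M. \<forall>n. (\<Sum>j<n. g j x) \<le> f x"
  shows "summable (\<lambda>n. \<integral>x. g n x \<partial>M)"
proof (rule summableI_nonneg_bounded)
  show "(\<Sum>j<n. \<integral>x. g j x \<partial>M) \<le> (\<integral>x. f x \<partial>M)" for n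
    unfolding Bochner_Integration.integral_sum[OF g, symmetric]
    using le by (intro integral_mono_AE Bochner_Integration.integrable_sum f g) auto
qed (simp add: nonneg)

text \<open>Along powers of two, truncation at the level \<open>2 ^ j\<close> and Chebyshev's inequality give
  summable error probabilities; monotonicity of the sums then fills the dyadic gaps at the cost
  of a factor two.\<close>

lemma (in prob_space) iid_nonneg_AE_sum_le:
  fixes Y :: "nat \<Rightarrow> 'a \<Rightarrow> real"
  assumes indep: "indep_vars (\<lambda>_. borel) Y UNIV"
    and D: "\<And>k. distr M borel (Y k) = D"
    and int: "integrable D (\<lambda>x. x)" and mean: "(\<integral>x. x \<partial>D) < e"
    and nonneg: "\<And>k \<omega>. Y k \<omega> \<ge> 0"
  shows "AE \<omega> in M. eventually (\<lambda>n. (\<Sum>k=1..n. Y k \<omega>) \<le> 2 * e * real n) sequentially"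
proof -
  have rv[measurable]: "random_variable borel (Y k)" for k
    using indep by (auto simp: indep_vars_def)
  interpret D: prob_space D
    unfolding D[of 0, symmetric] by (rule prob_space_distr) simp
  have [measurable_cong, simp]: "sets D = sets borel" and [simp]: "space D = UNIV"
    unfolding D[of 0, symmetric] by simp_all
  have expect: "expectation (\<lambda>\<omega>. f (Y k \<omega>)) = (\<integral>x. f x \<partial>D)"
    if [measurable]: "f \<in> borel_measurable borel" for f :: "real \<Rightarrow> real" and k
    unfolding D[of k, symmetric] by (subst integral_distr) auto
  have integ: "integrable M (\<lambda>\<omega>. f (Y k \<omega>)) \<longleftrightarrow> integrable D f"
    if [measurable]: "f \<in> borel_measurable borel" for f :: "real \<Rightarrow> real" and k
    unfolding D[of k, symmetric] by (subst integrable_distr_eq) auto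
  have AE_nonneg: "AE x in D. x \<ge> 0"
    unfolding D[of 0, symmetric] by (subst AE_distr_iff) (auto simp: nonneg)

  \<comment> \<open>The gap between the mean and \<open>e\<close> is the deviation that Chebyshev's
    inequality may leave over.\<close>
  define \<delta> where "\<delta> = e - (\<integral>x. x \<partial>D)"
  have "\<delta> > 0" using mean by (simp add: \<delta>_def)
  \<comment> \<open>The cutoff at zero makes \<open>T j\<close> bounded on the whole line; at the
    nonnegative values taken by the variables it changes nothing.\<close>
  define T :: "nat \<Rightarrow> real \<Rightarrow> real" where "T j x = (if x \<le> 2 ^ j \<and> x \<ge> 0 then x else 0)" for j x
  have T_meas[measurable]: "T j \<in> borel_measurable borel" for j
    unfolding T_def by measurable
  have T_bound: "0 \<le> T j x" "T j x \<le> 2 ^ j" for j x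
    by (auto simp: T_def)
  have T_int: "integrable D (T j)" "integrable D (\<lambda>x. (T j x)\<^sup>2)" for j
    using T_bound[of j]
    by (intro D.integrable_const_bound[where B = "2 ^ j"] D.integrable_const_bound[where B = "(2 ^ j)\<^sup>2"]
        AE_I2; simp add: power_mono)+
  \<comment> \<open>The two sources of error at scale \<open>2 ^ j\<close>: in \<open>B j\<close>
    truncation alters one of the summands, in \<open>C j\<close> the truncated sum is far from its
    expectation.\<close>
  define B where "B j = {\<omega>\<in>space M. \<exists>k\<in>{1..2 ^ j}. Y k \<omega> > 2 ^ j}" for j
  define C where "C j = {\<omega>\<in>space M. \<bar>(\<Sum>k=1..2 ^ j. T j (Y k \<omega>))
      - expectation (\<lambda>\<omega>. \<Sum>k=1..2 ^ j. T j (Y k \<omega>))\<bar> \<ge> \<delta> * 2 ^ j}" for j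
  have [measurable]: "B j \<in> events" "C j \<in> events" for j
    unfolding B_def C_def by measurable

  have ind_int: "integrable D (\<lambda>x. 2 ^ j * indicator {2 ^ j<..} x :: real)" for j
    by (intro integrable_mult_right integrable_real_indicator) (auto simp: less_top[symmetric])
  \<comment> \<open>A union bound over \<open>2 ^ j\<close> equally distributed variables, written
    as an integral to match \<open>sum_dyadic_indicator_le\<close>.\<close>
  have prob_B: "prob (B j) \<le> (\<integral>x. 2 ^ j * indicator {2 ^ j<..} x \<partial>D)" for j
  proof -
    have "B j = (\<Union>k\<in>{1..2 ^ j}. {\<omega>\<in>space M. Y k \<omega> \<in> {2 ^ j<..}})"
      by (auto simp: B_def)
    then have "prob (B j) \<le> (\<Sum>k\<in>{1..2 ^ j}. prob {\<omega>\<in>space M. Y k \<omega> \<in> {2 ^ j<..}})"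
      by (simp only:) (intro finite_measure_subadditive_finite; auto)
    also have "\<dots> = (\<Sum>k\<in>{1..2 ^ j::nat}. measure D {2 ^ j<..})"
    proof (intro sum.cong refl)
      show "prob {\<omega>\<in>space M. Y k \<omega> \<in> {2 ^ j<..}} = measure D {2 ^ j<..}" for k
        unfolding D[of k, symmetric]
        by (subst measure_distr) (auto intro!: arg_cong[where f = prob])
    qed
    finally show ?thesis by simp
  qed
  have "summable (\<lambda>j. \<integral>x. 2 ^ j * indicator {2 ^ j<..} x \<partial>D :: real)"
  proof (rule summable_integral_nonneg)
    show "integrable D (\<lambda>x. 2 * x)" using int by simp
    show "AE x in D. \<forall>n. (\<Sum>j<n. 2 ^ j * indicator {2 ^ j<..} x) \<le> 2 * x"
      using AE_nonneg by eventually_elim (blast intro: sum_dyadic_indicator_le)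
  qed (simp_all only: ind_int, auto)
  then have sum_B: "summable (\<lambda>j. prob (B j))"
    by (rule summable_comparison_test') (use prob_B in auto)

  \<comment> \<open>The variance is at most \<open>2 ^ j\<close> times the truncated second moment,
    and Chebyshev divides by the square of \<open>\<delta> * 2 ^ j\<close>. One factor
    \<open>2 ^ j\<close> survives in the denominator, as in
    \<open>sum_dyadic_truncated_square_le\<close>.\<close>
  have prob_C: "prob (C j) \<le> (\<integral>x. (T j x)\<^sup>2 / 2 ^ j \<partial>D) / \<delta>\<^sup>2" for j
  proof -
    have iv: "indep_vars (\<lambda>_. borel) (\<lambda>k \<omega>. T j (Y k \<omega>)) {1..2 ^ j}"
      by (rule indep_vars_compose2[OF indep_vars_subset[OF indep]]) auto
    have sq: "integrable M (\<lambda>\<omega>. (T j (Y k \<omega>))\<^sup>2)" for k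
      using integ[of "\<lambda>x. (T j x)\<^sup>2" k] T_int by simp
    have var: "variance (\<lambda>\<omega>. \<Sum>k=1..2 ^ j. T j (Y k \<omega>)) \<le> 2 ^ j * (\<integral>x. (T j x)\<^sup>2 \<partial>D)"
      using variance_sum_indep_vars_le(2)[OF _ iv sq] expect[of "\<lambda>x. (T j x)\<^sup>2"] by simp
    have "prob (C j) \<le> variance (\<lambda>\<omega>. \<Sum>k=1..2 ^ j. T j (Y k \<omega>)) / (\<delta> * 2 ^ j)\<^sup>2"
      unfolding C_def using \<open>\<delta> > 0\<close>
      by (intro Chebyshev_inequality variance_sum_indep_vars_le(1) iv sq) auto
    also have "\<dots> \<le> 2 ^ j * (\<integral>x. (T j x)\<^sup>2 \<partial>D) / (\<delta> * 2 ^ j)\<^sup>2"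
      using var by (intro divide_right_mono) auto
    also have "\<dots> = (\<integral>x. (T j x)\<^sup>2 / 2 ^ j \<partial>D) / \<delta>\<^sup>2"
      by (simp add: power2_eq_square)
    finally show ?thesis .
  qed
  have "summable (\<lambda>j. \<integral>x. (T j x)\<^sup>2 / 2 ^ j \<partial>D)"
  proof (rule summable_integral_nonneg)
    show "integrable D (\<lambda>x. 2 * x)" using int by simp
    show "AE x in D. \<forall>n. (\<Sum>j<n. (T j x)\<^sup>2 / 2 ^ j) \<le> 2 * x"
      using AE_nonneg
    proof eventually_elim
      case (elim x)
      with sum_dyadic_truncated_square_le[OF elim] show ?case
        by (simp add: T_def)
    qed
  qed (auto intro: T_int)
  then have "summable (\<lambda>j. (\<integral>x. (T j x)\<^sup>2 / 2 ^ j \<partial>D) / \<delta>\<^sup>2)"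
    by (rule summable_divide)
  then have sum_C: "summable (\<lambda>j. prob (C j))"
    by (rule summable_comparison_test') (use prob_C in auto)

  \<comment> \<open>Since only an upper bound on the sums is sought, it suffices that truncation
    does not raise the mean.\<close>
  have mean_T: "expectation (\<lambda>\<omega>. \<Sum>k=1..2 ^ j. T j (Y k \<omega>)) \<le> 2 ^ j * (\<integral>x. x \<partial>D)" for j
  proof -
    have "expectation (\<lambda>\<omega>. \<Sum>k=1..2 ^ j. T j (Y k \<omega>)) = 2 ^ j * (\<integral>x. T j x \<partial>D)"
      using integ[of "T j"] expect[of "T j"] T_int
      by (subst Bochner_Integration.integral_sum) auto
    also have "(\<integral>x. T j x \<partial>D) \<le> (\<integral>x. x \<partial>D)"
      using AE_nonneg by (intro integral_mono_AE T_int int) (auto simp: T_def)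
    finally show ?thesis by simp
  qed
  \<comment> \<open>Outside \<open>B j\<close> the truncated and original sums agree; outside
    \<open>C j\<close> the deviation is less than \<open>\<delta> * 2 ^ j\<close>, and
    \<open>\<delta>\<close> was chosen so that mean and deviation add up to
    \<open>e\<close>.\<close>
  have dyadic: "(\<Sum>k=1..2 ^ j. Y k \<omega>) \<le> e * 2 ^ j"
    if "\<omega> \<in> space M - B j" "\<omega> \<in> space M - C j" for \<omega> j
  proof -
    have "(\<Sum>k=1..2 ^ j. Y k \<omega>) = (\<Sum>k=1..2 ^ j. T j (Y k \<omega>))"
      using that(1) nonneg by (intro sum.cong refl) (auto simp: T_def B_def not_less)
    also have "\<dots> \<le> 2 ^ j * (\<integral>x. x \<partial>D) + \<delta> * 2 ^ j"
      using that(2) mean_T[of j] by (auto simp: C_def)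
    finally show ?thesis by (simp add: \<delta>_def algebra_simps)
  qed
  have "AE \<omega> in M. eventually (\<lambda>j. \<omega> \<in> space M - B j) sequentially"
    using sum_B by (intro borel_cantelli_AE1) (auto simp: less_top[symmetric])
  moreover have "AE \<omega> in M. eventually (\<lambda>j. \<omega> \<in> space M - C j) sequentially"
    using sum_C by (intro borel_cantelli_AE1) (auto simp: less_top[symmetric])
  ultimately show ?thesis
  proof eventually_elim
    case (elim \<omega>)
    then have "eventually (\<lambda>j. (\<Sum>k=1..2 ^ j. Y k \<omega>) \<le> e * 2 ^ j) sequentially"
      by eventually_elim (rule dyadic)
    then obtain J where J: "\<And>j. j \<ge> J \<Longrightarrow> (\<Sum>k=1..2 ^ j. Y k \<omega>) \<le> e * 2 ^ j"
      by (auto simp: eventually_sequentially)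
    have "e \<ge> 0"
      using integral_nonneg_AE[OF AE_nonneg] mean by simp
    have "(\<Sum>k=1..n. Y k \<omega>) \<le> 2 * e * real n" if "n \<ge> 2 ^ J" for n
    proof -
      have "n \<ge> 1" using that one_le_power[of "2::nat" J] by linarith
      then obtain j where j: "2 ^ j \<le> n" "n < 2 ^ (j + 1)"
        using ex_power_ivl1[of 2 n] by auto
      have "2 ^ J < (2 ^ (j + 1) :: nat)" using that j by linarith
      then have "J < j + 1" by (rule power_less_imp_less_exp[rotated]) simp
      have "(\<Sum>k=1..n. Y k \<omega>) \<le> (\<Sum>k=1..2 ^ (j + 1). Y k \<omega>)"
        using j by (intro sum_mono2) (auto simp: nonneg)
      also have "\<dots> \<le> e * 2 ^ (j + 1)"
        using \<open>J < j + 1\<close> by (intro J) simp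
      also have "\<dots> = 2 * e * real (2 ^ j)" by simp
      also have "\<dots> \<le> 2 * e * real n"
        using j(1) \<open>e \<ge> 0\<close> by (intro mult_left_mono) (auto simp only: of_nat_le_iff)
      finally show ?thesis .
    qed
    then show ?case by (auto simp: eventually_sequentially)
  qed
qed

text \<open>Hoeffding's inequality bounds the probability of a fixed deviation by a geometric
  sequence in \<open>n\<close>, so Borel-Cantelli applies directly along all
  \<open>n\<close>.\<close>

lemma (in prob_space) iid_unit_interval_SLLN:
  fixes Y :: "nat \<Rightarrow> 'a \<Rightarrow> real"
  assumes indep: "indep_vars (\<lambda>_. borel) Y UNIV"
    and D: "\<And>k. distr M borel (Y k) = D"
    and bound: "\<And>k \<omega>. Y k \<omega> \<in> {0..1}"
  shows "AE \<omega> in M. (\<lambda>n. (\<Sum>k=1..n. Y k \<omega>) / real n) \<longlonglongrightarrow> (\<integral>x. x \<partial>D)"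
proof -
  have rv[measurable]: "random_variable borel (Y k)" for k
    using indep by (auto simp: indep_vars_def)
  define \<mu> where "\<mu> = (\<integral>x. x \<partial>D)"
  have \<mu>: "expectation (Y 0) = \<mu>"
    unfolding \<mu>_def D[of 0, symmetric] by (subst integral_distr) auto
  define A where "A \<epsilon> n = {\<omega>\<in>space M. \<bar>(\<Sum>k=1..n. Y k \<omega>) / real n - \<mu>\<bar> \<ge> \<epsilon>}" for \<epsilon> n
  have [measurable]: "A \<epsilon> n \<in> events" for \<epsilon> n
    unfolding A_def by measurable
  have "AE \<omega> in M. eventually (\<lambda>n. \<omega> \<in> space M - A \<epsilon> n) sequentially" if "\<epsilon> > 0" for \<epsilon>
  proof (rule borel_cantelli_AE1)
    have le: "prob (A \<epsilon> n) \<le> 2 * exp (- 2 * \<epsilon>\<^sup>2) ^ n" if "n > 0" for n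
    proof -
      \<comment> \<open>The sums start at index 1; \<open>Y 0\<close> only represents the common
        law.\<close>
      interpret Hoeffding_ineq_iid M "{1..n}" Y "Y 0" 0 1 \<mu>
        by unfold_locales (use bound in \<open>auto simp: D \<mu> intro: indep_vars_subset[OF indep]\<close>)
      show ?thesis
        using Hoeffding_ineq_abs_ge'[of \<epsilon>] \<open>n > 0\<close> \<open>\<epsilon> > 0\<close>
        by (simp add: A_def exp_of_nat_mult[symmetric] mult_ac)
    qed
    have "summable (\<lambda>n. 2 * exp (- 2 * \<epsilon>\<^sup>2) ^ n)"
      using \<open>\<epsilon> > 0\<close> by (intro summable_mult summable_geometric) auto
    then show "summable (\<lambda>n. prob (A \<epsilon> n))"
    proof (rule summable_comparison_test'[where N = 1])
      show "norm (prob (A \<epsilon> n)) \<le> 2 * exp (- 2 * \<epsilon>\<^sup>2) ^ n" if "n \<ge> 1" for n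
        using le[of n] that by (simp only: real_norm_def abs_of_nonneg measure_nonneg)
    qed
  qed (auto simp: less_top[symmetric])
  \<comment> \<open>The exceptional null set depends on the deviation, so the deviations are
    restricted to a countable sequence tending to zero.\<close>
  then have "AE \<omega> in M. \<forall>i. eventually (\<lambda>n. \<omega> \<in> space M - A (inverse (real (Suc i))) n) sequentially"
    unfolding AE_all_countable by simp
  then show ?thesis
  proof eventually_elim
    case (elim \<omega>)
    show ?case unfolding \<mu>_def[symmetric]
    proof (rule tendstoI)
      fix \<epsilon> :: real assume "\<epsilon> > 0"
      then obtain i where i: "inverse (real (Suc i)) < \<epsilon>"
        using reals_Archimedean by blast
      from elim have "eventually (\<lambda>n. \<omega> \<in> space M - A (inverse (real (Suc i))) n) sequentially"
        by blast
      then show "eventually (\<lambda>n. dist ((\<Sum>k=1..n. Y k \<omega>) / real n) \<mu> < \<epsilon>) sequentially"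
        by eventually_elim (use i in \<open>auto simp: A_def dist_real_def\<close>)
    qed
  qed
qed

text \<open>A simple function is a finite combination of its values weighted by indicators. The
  sample mean is then the same combination weighted by empirical frequencies, which converge by the
  law for variables in the unit interval.\<close>

lemma (in prob_space) iid_simple_function_SLLN:
  fixes Y :: "nat \<Rightarrow> 'a \<Rightarrow> 'b" and h :: "'b \<Rightarrow> 'c::{banach, second_countable_topology}"
  assumes indep: "indep_vars (\<lambda>_. B) Y UNIV"
    and D: "\<And>k. distr M B (Y k) = D"
    and h: "simple_function B h"
  shows "AE \<omega> in M. (\<lambda>n. (1 / real n) *\<^sub>R (\<Sum>k=1..n. h (Y k \<omega>))) \<longlonglongrightarrow> (\<integral>x. h x \<partial>D)"
proof -
  have rv[measurable]: "random_variable B (Y k)" for k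
    using indep by (auto simp: indep_vars_def)
  interpret D: prob_space D
    unfolding D[of 0, symmetric] by (rule prob_space_distr) simp
  have [measurable_cong, simp]: "sets D = sets B" and [simp]: "space D = space B"
    unfolding D[of 0, symmetric] by simp_all
  define A where "A y = h -` {y} \<inter> space B" for y
  have fin: "finite (h ` space B)" and A[measurable]: "A y \<in> sets B" for y
    using h by (auto simp: A_def intro: simple_functionD)
  have h_eq: "h x = (\<Sum>y\<in>h ` space B. indicator (A y) x *\<^sub>R y)" if "x \<in> space B" for x
  proof -
    have "(\<Sum>y\<in>h ` space B. indicator (A y) x *\<^sub>R y) = (\<Sum>y\<in>h ` space B. if y = h x then y else 0)"
      using that by (intro sum.cong refl) (auto simp: A_def)
    also have "\<dots> = h x" using fin that by simp
    finally show ?thesis by simp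
  qed
  have "AE \<omega> in M. (\<lambda>n. (\<Sum>k=1..n. indicator (A y) (Y k \<omega>)) / real n) \<longlonglongrightarrow> measure D (A y)" for y
  proof -
    have "AE \<omega> in M. (\<lambda>n. (\<Sum>k=1..n. indicator (A y) (Y k \<omega>)) / real n)
        \<longlonglongrightarrow> (\<integral>x. x \<partial>distr D borel (indicator (A y)))"
    proof (rule iid_unit_interval_SLLN)
      show "indep_vars (\<lambda>_. borel) (\<lambda>k \<omega>. indicator (A y) (Y k \<omega>)) UNIV"
        by (rule indep_vars_compose2[OF indep]) simp
      show "distr M borel (\<lambda>\<omega>. indicator (A y) (Y k \<omega>)) = distr D borel (indicator (A y))" for k
        unfolding D[of k, symmetric] by (subst distr_distr) (auto simp: comp_def)
    qed (auto simp: indicator_def)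
    then show ?thesis by (simp add: integral_distr)
  qed
  then have "AE \<omega> in M. \<forall>y\<in>h ` space B.
      (\<lambda>n. (\<Sum>k=1..n. indicator (A y) (Y k \<omega>)) / real n) \<longlonglongrightarrow> measure D (A y)"
    using fin by (intro AE_finite_allI)
  moreover have "AE \<omega> in M. \<omega> \<in> space M" by (rule AE_space)
  ultimately show ?thesis
  proof eventually_elim
    case (elim \<omega>)
    have "(1 / real n) *\<^sub>R (\<Sum>k=1..n. h (Y k \<omega>))
        = (\<Sum>y\<in>h ` space B. ((\<Sum>k=1..n. indicator (A y) (Y k \<omega>)) / real n) *\<^sub>R y)" for n
    proof -
      have "(\<Sum>k=1..n. h (Y k \<omega>)) = (\<Sum>k=1..n. \<Sum>y\<in>h ` space B. indicator (A y) (Y k \<omega>) *\<^sub>R y)"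
        using elim(2) measurable_space[OF rv] by (intro sum.cong refl h_eq) auto
      also have "\<dots> = (\<Sum>y\<in>h ` space B. (\<Sum>k=1..n. indicator (A y) (Y k \<omega>)) *\<^sub>R y)"
        by (subst sum.swap) (simp add: scaleR_sum_left)
      finally show ?thesis by (simp add: scaleR_sum_right)
    qed
    moreover have "(\<integral>x. h x \<partial>D) = (\<Sum>y\<in>h ` space B. measure D (A y) *\<^sub>R y)"
    proof -
      have ind: "integrable D (indicator (A y) :: 'b \<Rightarrow> real)" for y
        by (intro integrable_real_indicator) (simp_all add: D.emeasure_eq_measure)
      have "(\<integral>x. h x \<partial>D) = (\<integral>x. (\<Sum>y\<in>h ` space B. indicator (A y) x *\<^sub>R y) \<partial>D)"
        by (rule Bochner_Integration.integral_cong[OF refl h_eq]) simp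
      also have "\<dots> = (\<Sum>y\<in>h ` space B. measure D (A y) *\<^sub>R y)"
      proof (subst Bochner_Integration.integral_sum)
        show "integrable D (\<lambda>x. indicator (A y) x *\<^sub>R y)" for y
          by (intro integrable_scaleR_left ind)
        show "(\<Sum>y\<in>h ` space B. \<integral>x. indicator (A y) x *\<^sub>R y \<partial>D) = (\<Sum>y\<in>h ` space B. measure D (A y) *\<^sub>R y)"
          by (intro sum.cong refl) (subst integral_scaleR_left, rule ind, simp add: sets.Int_space_eq2[OF A])
      qed
      finally show ?thesis .
    qed
    ultimately show ?case
      using elim(1) by (simp only:) (intro tendsto_sum tendsto_scaleR tendsto_const, blast)
  qed
qed

text \<open>A simple function \<open>h\<close> with \<open>E[norm (Y - h Y)] < e\<close> reduces the claim to the two cases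
  above: the means of \<open>h Y\<^sub>k\<close> converge and those of \<open>Y\<^sub>k - h Y\<^sub>k\<close> are eventually at most \<open>2 e\<close>.\<close>

theorem (in prob_space) iid_SLLN:
  fixes Y :: "nat \<Rightarrow> 'a \<Rightarrow> 'b::{banach, second_countable_topology}"
  assumes indep: "indep_vars (\<lambda>_. borel) Y UNIV"
    and D: "\<And>k. distr M borel (Y k) = D"
    and int: "integrable D (\<lambda>x. x)"
  shows "AE \<omega> in M. (\<lambda>n. (1 / real n) *\<^sub>R (\<Sum>k=1..n. Y k \<omega>)) \<longlonglongrightarrow> (\<integral>x. x \<partial>D)"
proof -
  have rv[measurable]: "random_variable borel (Y k)" for k
    using indep by (auto simp: indep_vars_def)
  interpret D: prob_space D
    unfolding D[of 0, symmetric] by (rule prob_space_distr) simp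
  have [measurable_cong, simp]: "sets D = sets borel" and [simp]: "space D = UNIV"
    unfolding D[of 0, symmetric] by simp_all
  define m where "m = (\<integral>x. x \<partial>D)"
  \<comment> \<open>The bound \<open>4 * e\<close> is made up of \<open>2 * e\<close> for the mean
    error of approximation, \<open>e\<close> for the sample means of \<open>h\<close>, and
    \<open>e\<close> for the distance of the two expectations.\<close>
  have approx: "AE \<omega> in M. eventually (\<lambda>n. norm ((1 / real n) *\<^sub>R (\<Sum>k=1..n. Y k \<omega>) - m) \<le> 4 * e) sequentially"
    if "e > 0" for e
  proof -
    \<comment> \<open>Bochner integrability is by definition approximability in the
      \<open>L\<^sup>1\<close> sense by simple functions, here applied to the identity under the
      common law \<open>D\<close>.\<close>
    obtain s where s: "\<And>i. Bochner_Integration.simple_bochner_integrable D (s i)"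
      and lim: "(\<lambda>i. \<integral>\<^sup>+x. norm (x - s i x) \<partial>D) \<longlonglongrightarrow> 0"
      using int by (auto simp: integrable.simps has_bochner_integral.simps)
    from order_tendstoD(2)[OF lim, of e] \<open>e > 0\<close> obtain i
      where i: "(\<integral>\<^sup>+x. norm (x - s i x) \<partial>D) < e"
      by (auto simp: eventually_sequentially)
    define h where "h = s i"
    have h: "simple_function borel h"
      using s[of i] by (auto simp: h_def Bochner_Integration.simple_bochner_integrable.simps simple_function_def)
    have [measurable]: "h \<in> borel_measurable borel"
      using h by (rule borel_measurable_simple_function)
    have h_int: "integrable D h"
      using has_bochner_integral_simple_bochner_integrable[OF s[of i]]
      by (auto simp: h_def intro: integrable.intros)
    have d_int: "integrable D (\<lambda>x. norm (x - h x))"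
      using int h_int by (intro integrable_norm Bochner_Integration.integrable_diff)
    have "(\<integral>\<^sup>+x. norm (x - h x) \<partial>D) = ennreal (\<integral>x. norm (x - h x) \<partial>D)"
      by (intro nn_integral_eq_integral d_int) auto
    then have d_less: "(\<integral>x. norm (x - h x) \<partial>D) < e"
      using i by (auto simp: h_def ennreal_less_iff)
    have mean_h: "norm ((\<integral>x. h x \<partial>D) - m) \<le> e"
    proof -
      have "(\<integral>x. h x \<partial>D) - m = (\<integral>x. h x - x \<partial>D)"
        unfolding m_def using int h_int by simp
      also have "norm \<dots> \<le> (\<integral>x. norm (h x - x) \<partial>D)"
        by (rule integral_norm_bound)
      finally show ?thesis using d_less by (simp add: norm_minus_commute)
    qed
    have "AE \<omega> in M. eventually (\<lambda>n. (\<Sum>k=1..n. norm (Y k \<omega> - h (Y k \<omega>))) \<le> 2 * e * real n) sequentially"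
    proof (rule iid_nonneg_AE_sum_le)
      show "indep_vars (\<lambda>_. borel) (\<lambda>k \<omega>. norm (Y k \<omega> - h (Y k \<omega>))) UNIV"
        by (rule indep_vars_compose2[OF indep]) simp
      show "distr M borel (\<lambda>\<omega>. norm (Y k \<omega> - h (Y k \<omega>))) = distr D borel (\<lambda>x. norm (x - h x))" for k
        unfolding D[of k, symmetric] by (subst distr_distr) (auto simp: comp_def)
    qed (use d_int d_less in \<open>auto simp: integrable_distr_eq integral_distr\<close>)
    moreover have "AE \<omega> in M. (\<lambda>n. (1 / real n) *\<^sub>R (\<Sum>k=1..n. h (Y k \<omega>))) \<longlonglongrightarrow> (\<integral>x. h x \<partial>D)"
      using indep D h by (rule iid_simple_function_SLLN)
    ultimately show ?thesis
    proof eventually_elim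
      case (elim \<omega>)
      from elim(2) have "eventually (\<lambda>n. dist ((1 / real n) *\<^sub>R (\<Sum>k=1..n. h (Y k \<omega>))) (\<integral>x. h x \<partial>D) < e) sequentially"
        using \<open>e > 0\<close> by (rule tendstoD)
      with elim(1) eventually_gt_at_top[of 0] show ?case
      proof eventually_elim
        case (elim n)
        let ?d = "(1 / real n) *\<^sub>R (\<Sum>k=1..n. Y k \<omega> - h (Y k \<omega>))"
          and ?h = "(1 / real n) *\<^sub>R (\<Sum>k=1..n. h (Y k \<omega>))"
        have "norm ?d \<le> (\<Sum>k=1..n. norm (Y k \<omega> - h (Y k \<omega>))) / real n"
          by (simp add: divide_right_mono norm_sum)
        also have "\<dots> \<le> 2 * e"
          using elim by (simp add: field_simps)
        finally have "norm ?d \<le> 2 * e" .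
        moreover have "norm (?h - (\<integral>x. h x \<partial>D)) \<le> e"
          using elim by (simp add: dist_norm)
        moreover have "(1 / real n) *\<^sub>R (\<Sum>k=1..n. Y k \<omega>) - m
            = ?d + (?h - (\<integral>x. h x \<partial>D)) + ((\<integral>x. h x \<partial>D) - m)"
          by (simp add: sum_subtractf scaleR_diff_right)
        ultimately show ?case
          using mean_h norm_triangle_ineq[of "?d + (?h - (\<integral>x. h x \<partial>D))" "(\<integral>x. h x \<partial>D) - m"]
            norm_triangle_ineq[of ?d "?h - (\<integral>x. h x \<partial>D)"] by simp
      qed
    qed
  qed
  have "AE \<omega> in M. \<forall>i. eventually (\<lambda>n. norm ((1 / real n) *\<^sub>R (\<Sum>k=1..n. Y k \<omega>) - m)
      \<le> 4 * inverse (real (Suc i))) sequentially"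
    unfolding AE_all_countable by (intro allI approx) simp
  then show ?thesis
  proof eventually_elim
    case (elim \<omega>)
    show ?case unfolding m_def[symmetric]
    proof (rule tendstoI)
      fix \<epsilon> :: real assume "\<epsilon> > 0"
      then obtain i where i: "inverse (real (Suc i)) < \<epsilon> / 4"
        using reals_Archimedean[of "\<epsilon> / 4"] by auto
      from elim have "eventually (\<lambda>n. norm ((1 / real n) *\<^sub>R (\<Sum>k=1..n. Y k \<omega>) - m)
          \<le> 4 * inverse (real (Suc i))) sequentially" by blast
      then show "eventually (\<lambda>n. dist ((1 / real n) *\<^sub>R (\<Sum>k=1..n. Y k \<omega>)) m < \<epsilon>) sequentially"
        by eventually_elim (use i in \<open>auto simp: dist_norm\<close>)
    qed
  qed
qed


section \<open>Finite powers of a Banach space\<close>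

lemma bpow_iff: "x \<in> bpow S \<longleftrightarrow> x \<in> extensional S"
  by (auto simp: bpow_def PiE_def)

lemma restrict_in_bpow [simp]: "restrict f S \<in> bpow S"
  by (simp add: bpow_iff)

text \<open>Distance zero determines a family only on \<open>S\<close>; extensionality fixes its
  values elsewhere.\<close>

lemma bpow_metric:
  assumes "finite S"
  shows "Metric_space (bpow S) (\<lambda>x y. bpow_norm S (\<lambda>s. x s - y s :: 'b::real_normed_vector))"
proof
  fix x y z :: "'a \<Rightarrow> 'b"
  show "0 \<le> bpow_norm S (\<lambda>s. x s - y s)"
    by (simp add: bpow_norm_def sum_nonneg)
  show "bpow_norm S (\<lambda>s. x s - y s) = bpow_norm S (\<lambda>s. y s - x s)"
    by (simp add: bpow_norm_def norm_minus_commute)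
  show "bpow_norm S (\<lambda>s. x s - z s) \<le> bpow_norm S (\<lambda>s. x s - y s) + bpow_norm S (\<lambda>s. y s - z s)"
    unfolding bpow_norm_def sum.distrib[symmetric]
    by (intro sum_mono norm_diff_triangle_le[OF order_refl order_refl])
  show "bpow_norm S (\<lambda>s. x s - y s) = 0 \<longleftrightarrow> x = y" if "x \<in> bpow S" "y \<in> bpow S"
    using assms that
    by (auto simp: bpow_norm_def sum_nonneg_eq_0_iff bpow_iff intro: extensionalityI)
qed

lemma norm_le_bpow_norm: "finite S \<Longrightarrow> s \<in> S \<Longrightarrow> norm (x s) \<le> bpow_norm S x"
  unfolding bpow_norm_def by (rule member_le_sum) auto

text \<open>Coordinates are 1-Lipschitz for the sum norm, so a ball in the power can take its radius
  from a ball around the coordinate. This is the source of measurability of the coordinates.\<close>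

lemma openin_bpow_coordinate:
  fixes U :: "'b::real_normed_vector set"
  assumes "finite S" "s \<in> S" "open U"
  shows "openin (bpow_topology S) {x\<in>bpow S. x s \<in> U}"
proof -
  interpret Metric_space "bpow S" "\<lambda>x y. bpow_norm S (\<lambda>s. x s - y s :: 'b)"
    using \<open>finite S\<close> by (rule bpow_metric)
  show ?thesis
    unfolding bpow_topology_def openin_mtopology
  proof (intro conjI allI impI)
    fix x assume "x \<in> {x\<in>bpow S. x s \<in> U}"
    with \<open>open U\<close> obtain e where e: "e > 0" "ball (x s) e \<subseteq> U"
      by (auto simp: open_contains_ball)
    have "mball x e \<subseteq> {x\<in>bpow S. x s \<in> U}"
    proof
      fix y assume y: "y \<in> mball x e"
      then have "norm (x s - y s) < e"
        using norm_le_bpow_norm[OF assms(1,2), of "\<lambda>s. x s - y s"] by (simp add: in_mball)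
      with e y show "y \<in> {x\<in>bpow S. x s \<in> U}"
        by (auto simp: in_mball dist_norm)
    qed
    with e show "\<exists>r>0. mball x r \<subseteq> {x\<in>bpow S. x s \<in> U}" by blast
  qed auto
qed

text \<open>The generators passed to \<open>sigma\<close> must be subsets of the carrier; this is
  known because they are the open sets of a metric topology on it.\<close>

lemma space_bpow_borel: "finite S \<Longrightarrow> space (bpow_borel S :: ('s \<Rightarrow> 'b::real_normed_vector) measure) = bpow S"
  and sets_bpow_borel: "finite S \<Longrightarrow> sets (bpow_borel S :: ('s \<Rightarrow> 'b::real_normed_vector) measure)
    = sigma_sets (bpow S) {U. openin (bpow_topology S) U}"
proof -
  assume "finite S"
  then interpret Metric_space "bpow S" "\<lambda>x y. bpow_norm S (\<lambda>s. x s - y s :: 'b)"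
    by (rule bpow_metric)
  have "{U. openin (bpow_topology S) U} \<subseteq> Pow (bpow S :: ('s \<Rightarrow> 'b) set)"
    using openin_subset[of mtopology] by (auto simp: bpow_topology_def)
  then show "space (bpow_borel S :: ('s \<Rightarrow> 'b) measure) = bpow S"
    and "sets (bpow_borel S :: ('s \<Rightarrow> 'b) measure) = sigma_sets (bpow S) {U. openin (bpow_topology S) U}"
    by (simp_all add: bpow_borel_def)
qed

lemma measurable_bpow_coordinate:
  assumes "finite S" "s \<in> S"
  shows "(\<lambda>x. x s :: 'b::real_normed_vector) \<in> bpow_borel S \<rightarrow>\<^sub>M borel"
proof (rule borel_measurableI)
  fix U :: "'b set" assume "open U"
  with assms have "openin (bpow_topology S) {x\<in>bpow S. x s \<in> U}"
    by (rule openin_bpow_coordinate)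
  then show "(\<lambda>x. x s) -` U \<inter> space (bpow_borel S) \<in> sets (bpow_borel S)"
    using \<open>finite S\<close>
    by (auto simp: space_bpow_borel sets_bpow_borel vimage_def Int_def conj_commute)
qed

text \<open>The distance to \<open>l\<close> is a finite sum of coordinate distances, so
  coordinatewise limits suffice.\<close>

lemma limitin_bpow_topologyI:
  fixes l :: "'s \<Rightarrow> 'b::real_normed_vector"
  assumes "finite S" "l \<in> bpow S" "\<And>n. f n \<in> bpow S"
    and lim: "\<And>s. s \<in> S \<Longrightarrow> (\<lambda>n. f n s) \<longlonglongrightarrow> l s"
  shows "limitin (bpow_topology S) f l sequentially"
proof -
  interpret Metric_space "bpow S" "\<lambda>x y. bpow_norm S (\<lambda>s. x s - y s :: 'b)"
    using \<open>finite S\<close> by (rule bpow_metric)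
  have "(\<lambda>n. bpow_norm S (\<lambda>s. f n s - l s)) \<longlonglongrightarrow> (\<Sum>s\<in>S. norm (l s - l s))"
    unfolding bpow_norm_def by (intro tendsto_intros lim)
  then have "(\<lambda>n. bpow_norm S (\<lambda>s. f n s - l s)) \<longlonglongrightarrow> 0" by simp
  then show ?thesis
    using assms by (auto simp: bpow_topology_def limitin_metric intro: order_tendstoD(2))
qed

text \<open>These functionals let the power inherit the separation of points from the Banach space,
  which gives uniqueness of the Pettis integral.\<close>

lemma bpow_functional_coordinate:
  assumes g: "bounded_linear g" and "finite S" "s \<in> S"
  shows "bpow_functional S (\<lambda>x. g (x s))"
proof -
  interpret bounded_linear g by (rule g)
  obtain C where C: "C > 0" "\<And>y. norm (g y) \<le> norm y * C"
    using pos_bounded by blast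
  have "\<bar>g (x s)\<bar> \<le> C * bpow_norm S x" for x
  proof -
    have "\<bar>g (x s)\<bar> \<le> C * norm (x s)"
      using C(2)[of "x s"] by (simp add: mult.commute)
    also have "\<dots> \<le> C * bpow_norm S x"
      using \<open>C > 0\<close> by (intro mult_left_mono norm_le_bpow_norm assms) simp
    finally show ?thesis .
  qed
  with \<open>s \<in> S\<close> show ?thesis
    by (auto simp: bpow_functional_def add scaleR)
qed

text \<open>Each \<open>g s\<close> is \<open>f\<close> composed with the embedding
  \<open>i s\<close> of the space as coordinate \<open>s\<close>, and a family is the finite sum of
  its embedded coordinates. Integration against \<open>f\<close> thereby reduces to single
  coordinates.\<close>

lemma bpow_functional_decompose:
  fixes f :: "('s \<Rightarrow> 'b::real_normed_vector) \<Rightarrow> real"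
  assumes f: "bpow_functional S f" and "finite S"
  obtains g where "\<And>s. s \<in> S \<Longrightarrow> bounded_linear (g s)"
    "\<And>x. x \<in> bpow S \<Longrightarrow> f x = (\<Sum>s\<in>S. g s (x s))"
proof -
  define i where "i s b = (\<lambda>t\<in>S. if t = s then b else 0)" for s and b :: 'b
  have add: "f (\<lambda>s\<in>S. x s + y s) = f x + f y" if "x \<in> bpow S" "y \<in> bpow S" for x y
    using f that by (auto simp: bpow_functional_def)
  have scale: "f (\<lambda>s\<in>S. c *\<^sub>R x s) = c * f x" if "x \<in> bpow S" for c x
    using f that by (auto simp: bpow_functional_def)
  obtain C where C: "\<And>x. x \<in> bpow S \<Longrightarrow> \<bar>f x\<bar> \<le> C * bpow_norm S x"
    using f unfolding bpow_functional_def by blast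
  have i: "i s b \<in> bpow S" for s b
    by (simp add: i_def)
  have norm_i: "bpow_norm S (i s b) = norm b" if "s \<in> S" for s b
  proof -
    have "bpow_norm S (i s b) = (\<Sum>t\<in>S. if t = s then norm b else 0)"
      unfolding bpow_norm_def by (intro sum.cong refl) (auto simp: i_def)
    with that \<open>finite S\<close> show ?thesis by simp
  qed
  have "bounded_linear (\<lambda>b. f (i s b))" if "s \<in> S" for s
  proof (rule bounded_linear_intro[where K = C])
    fix b b' :: 'b and c :: real
    have "i s (b + b') = (\<lambda>t\<in>S. i s b t + i s b' t)" "i s (c *\<^sub>R b) = (\<lambda>t\<in>S. c *\<^sub>R i s b t)"
      by (auto simp: i_def fun_eq_iff)
    then show "f (i s (b + b')) = f (i s b) + f (i s b')" "f (i s (c *\<^sub>R b)) = c *\<^sub>R f (i s b)"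
      by (simp_all add: add scale i)
    show "norm (f (i s b)) \<le> norm b * C"
      using C[OF i, of s b] norm_i[OF that, of b] by (simp add: mult.commute)
  qed
  moreover have "f x = (\<Sum>s\<in>S. f (i s (x s)))" if "x \<in> bpow S" for x
  proof -
    \<comment> \<open>Induction on the support: the entries of \<open>x\<close> are switched on one
      at a time.\<close>
    have "f (\<lambda>s\<in>S. if s \<in> T then x s else 0) = (\<Sum>s\<in>T. f (i s (x s)))" if "finite T" "T \<subseteq> S" for T
      using that
    proof (induction T rule: finite_induct)
      case empty
      \<comment> \<open>The zero family is its own multiple by zero, so homogeneity makes
        \<open>f\<close> vanish there.\<close>
      show ?case using scale[OF restrict_in_bpow, of 0 "\<lambda>_. 0"] by (simp add: restrict_def)
    next
      case (insert s T)
      have "(\<lambda>t\<in>S. if t \<in> insert s T then x t else 0)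
          = (\<lambda>t\<in>S. i s (x s) t + (\<lambda>t\<in>S. if t \<in> T then x t else 0) t)"
        using insert.hyps by (auto simp: i_def fun_eq_iff)
      then have "f (\<lambda>t\<in>S. if t \<in> insert s T then x t else 0)
          = f (i s (x s)) + f (\<lambda>t\<in>S. if t \<in> T then x t else 0)"
        by (simp only: add i restrict_in_bpow)
      also have "f (\<lambda>t\<in>S. if t \<in> T then x t else 0) = (\<Sum>s\<in>T. f (i s (x s)))"
        using insert by blast
      finally show ?case
        unfolding sum.insert[OF insert.hyps] .
    qed
    from this[of S] \<open>finite S\<close> have "f (\<lambda>s\<in>S. if s \<in> S then x s else 0) = (\<Sum>s\<in>S. f (i s (x s)))"
      by simp
    moreover have "(\<lambda>s\<in>S. if s \<in> S then x s else 0) = x"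
      using that by (auto simp: bpow_iff extensional_def fun_eq_iff)
    ultimately show ?thesis by simp
  qed
  ultimately show thesis by (rule that)
qed

text \<open>Bounded linear maps commute with the Bochner integral, so the coordinatewise integrals
  satisfy the defining equations. Two solutions differing at some \<open>s\<close> would be
  separated by a functional of that coordinate.\<close>

lemma pettis_integral_eq_coordinatewise:
  fixes V :: "'w \<Rightarrow> 's \<Rightarrow> 'b::{banach, second_countable_topology}"
  assumes "finite S" and V: "\<And>\<omega>. \<omega> \<in> space M \<Longrightarrow> V \<omega> \<in> bpow S"
    and int: "\<And>s. s \<in> S \<Longrightarrow> integrable M (\<lambda>\<omega>. V \<omega> s)"
  shows "pettis_integral M S V = (\<lambda>s\<in>S. \<integral>\<omega>. V \<omega> s \<partial>M)"
  unfolding pettis_integral_def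
proof (rule the_equality)
  let ?e = "\<lambda>s\<in>S. \<integral>\<omega>. V \<omega> s \<partial>M"
  show e: "has_pettis_integral M S V ?e"
    unfolding has_pettis_integral_def
  proof (intro conjI allI impI)
    fix f :: "('s \<Rightarrow> 'b) \<Rightarrow> real" assume "bpow_functional S f"
    then obtain g where g: "\<And>s. s \<in> S \<Longrightarrow> bounded_linear (g s)"
      and f: "\<And>x. x \<in> bpow S \<Longrightarrow> f x = (\<Sum>s\<in>S. g s (x s))"
      using \<open>finite S\<close> by (rule bpow_functional_decompose) blast
    have g_int: "integrable M (\<lambda>\<omega>. g s (V \<omega> s))" if "s \<in> S" for s
      using g[OF that] int[OF that] by (rule integrable_bounded_linear)
    then have "integrable M (\<lambda>\<omega>. \<Sum>s\<in>S. g s (V \<omega> s))"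
      by (rule Bochner_Integration.integrable_sum)
    moreover have "f (V \<omega>) = (\<Sum>s\<in>S. g s (V \<omega> s))" if "\<omega> \<in> space M" for \<omega>
      by (rule f[OF V[OF that]])
    ultimately show "integrable M (\<lambda>\<omega>. f (V \<omega>))"
      by (simp cong: Bochner_Integration.integrable_cong)
    have "(\<integral>\<omega>. f (V \<omega>) \<partial>M) = (\<integral>\<omega>. (\<Sum>s\<in>S. g s (V \<omega> s)) \<partial>M)"
      by (intro Bochner_Integration.integral_cong refl f V)
    also have "\<dots> = (\<Sum>s\<in>S. g s (\<integral>\<omega>. V \<omega> s \<partial>M))"
      using g_int integral_bounded_linear[OF g int] by simp
    also have "\<dots> = f ?e"
      by (subst f) auto
    finally show "f ?e = (\<integral>\<omega>. f (V \<omega>) \<partial>M)" ..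
  qed simp
  fix e' assume e': "has_pettis_integral M S V e'"
  have "e' s = ?e s" if "s \<in> S" for s
  proof (rule ccontr)
    assume "e' s \<noteq> ?e s"
    then have "e' s - ?e s \<noteq> 0" by simp
    then obtain g :: "'b \<Rightarrow> real" where g: "bounded_linear g" "g (e' s - ?e s) \<noteq> 0"
      by (rule exists_bounded_linear_nonzero)
    then have "bpow_functional S (\<lambda>x. g (x s))"
      using \<open>finite S\<close> that by (intro bpow_functional_coordinate)
    then have "g (e' s) = (\<integral>\<omega>. g (V \<omega> s) \<partial>M)" "g (?e s) = (\<integral>\<omega>. g (V \<omega> s) \<partial>M)"
      using e e' unfolding has_pettis_integral_def by blast+
    with g show False
      by (simp add: linear_diff[OF bounded_linear.linear])
  qed
  moreover have "e' \<in> bpow S"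
    using e' by (simp add: has_pettis_integral_def)
  ultimately show "e' = ?e"
    by (intro extensionalityI[of _ S]) (auto simp: bpow_iff)
qed

text \<open>Each coordinate of the copies is again i.i.d., with the law of that coordinate of
  \<open>V\<close>, and is integrable because the sum norm dominates it. The finitely many
  exceptional null sets combine into one.\<close>

theorem bpow_SLLN:
  fixes V :: "'w \<Rightarrow> 's \<Rightarrow> 'b::{banach, second_countable_topology}"
  assumes "finite S" "prob_space N"
    and V: "V \<in> M \<rightarrow>\<^sub>M bpow_borel S"
    and copies: "independent_copies M S V N Vs"
    and finite_norm: "(\<integral>\<^sup>+ \<omega>. ennreal (bpow_norm S (V \<omega>)) \<partial>M) < \<infinity>"
  shows "AE \<omega> in N. limitin (bpow_topology S) (\<lambda>n. sample_mean S Vs n \<omega>)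
    (pettis_integral M S V) sequentially"
proof -
  interpret N: prob_space N by fact
  have indep: "N.indep_vars (\<lambda>_. bpow_borel S) Vs UNIV"
    and distr: "\<And>k. distr N (bpow_borel S) (Vs k) = distr M (bpow_borel S) V"
    using copies by (auto simp: independent_copies_def)
  have Vs[measurable]: "Vs k \<in> N \<rightarrow>\<^sub>M bpow_borel S" for k
    using indep by (auto simp: N.indep_vars_def)
  note V[measurable]
  have coord[measurable]: "(\<lambda>x. x s :: 'b) \<in> bpow_borel S \<rightarrow>\<^sub>M borel" if "s \<in> S" for s
    using \<open>finite S\<close> that by (rule measurable_bpow_coordinate)
  have int: "integrable M (\<lambda>\<omega>. V \<omega> s)" if "s \<in> S" for s
  proof (rule integrableI_bounded)
    show "(\<lambda>\<omega>. V \<omega> s) \<in> borel_measurable M"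
      using that by measurable
    have "(\<integral>\<^sup>+ \<omega>. ennreal (norm (V \<omega> s)) \<partial>M) \<le> (\<integral>\<^sup>+ \<omega>. ennreal (bpow_norm S (V \<omega>)) \<partial>M)"
      using \<open>finite S\<close> that by (intro nn_integral_mono ennreal_leI norm_le_bpow_norm)
    with finite_norm show "(\<integral>\<^sup>+ \<omega>. ennreal (norm (V \<omega> s)) \<partial>M) < \<infinity>"
      by (rule le_less_trans[rotated])
  qed
  have pettis: "pettis_integral M S V = (\<lambda>s\<in>S. \<integral>\<omega>. V \<omega> s \<partial>M)"
    using \<open>finite S\<close> measurable_space[OF V] int
    by (intro pettis_integral_eq_coordinatewise) (auto simp: space_bpow_borel)
  have "AE \<omega> in N. (\<lambda>n. (1 / real n) *\<^sub>R (\<Sum>k=1..n. Vs k \<omega> s)) \<longlonglongrightarrow> (\<integral>\<omega>. V \<omega> s \<partial>M)" if "s \<in> S" for s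
  proof -
    note [measurable] = coord[OF that]
    have "AE \<omega> in N. (\<lambda>n. (1 / real n) *\<^sub>R (\<Sum>k=1..n. Vs k \<omega> s))
        \<longlonglongrightarrow> (\<integral>x. x \<partial>distr M borel (\<lambda>\<omega>. V \<omega> s))"
    proof (rule N.iid_SLLN)
      show "N.indep_vars (\<lambda>_. borel) (\<lambda>k \<omega>. Vs k \<omega> s) UNIV"
        by (rule N.indep_vars_compose2[OF indep]) (rule coord[OF that])
      show "distr N borel (\<lambda>\<omega>. Vs k \<omega> s) = distr M borel (\<lambda>\<omega>. V \<omega> s)" for k
      proof -
        have "distr N borel (\<lambda>\<omega>. Vs k \<omega> s) = distr (distr N (bpow_borel S) (Vs k)) borel (\<lambda>x. x s)"
          by (subst distr_distr) (auto simp: comp_def)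
        also have "\<dots> = distr M borel (\<lambda>\<omega>. V \<omega> s)"
          unfolding distr by (subst distr_distr) (auto simp: comp_def)
        finally show ?thesis .
      qed
      show "integrable (distr M borel (\<lambda>\<omega>. V \<omega> s)) (\<lambda>x. x)"
        using int[OF that] by (subst integrable_distr_eq) auto
    qed
    then show ?thesis by (simp add: integral_distr)
  qed
  then have "AE \<omega> in N. \<forall>s\<in>S. (\<lambda>n. (1 / real n) *\<^sub>R (\<Sum>k=1..n. Vs k \<omega> s)) \<longlonglongrightarrow> (\<integral>\<omega>. V \<omega> s \<partial>M)"
    using \<open>finite S\<close> by (intro AE_finite_allI)
  then show ?thesis
  proof eventually_elim
    case (elim \<omega>)
    then show ?case
      unfolding pettis using \<open>finite S\<close>
      by (intro limitin_bpow_topologyI) (auto simp: sample_mean_def)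
  qed
qed


section \<open>Voxels\<close>

text \<open>A cube is determined by its lower corner. The corners of the cubes in question are
  uniformly discrete by disjointness and bounded by the size of the cubes, hence finite in
  number.\<close>

lemma finite_cubes_meeting_bounded:
  fixes B :: "(real^'d) set"
  assumes "s > 0" and Q: "cube_partition s Q" and B: "bounded B"
  shows "finite {c\<in>Q. c \<inter> B \<noteq> {}}"
proof -
  define cube :: "real^'d \<Rightarrow> (real^'d) set" where "cube t = (+) t ` {x. \<forall>i. 0 \<le> x $ i \<and> x $ i < s}" for t
  have cube_iff: "x \<in> cube t \<longleftrightarrow> (\<forall>i. t $ i \<le> x $ i \<and> x $ i < t $ i + s)" for x t
  proof -
    have "x \<in> cube t \<longleftrightarrow> x - t \<in> {x. \<forall>i. 0 \<le> x $ i \<and> x $ i < s}" (is "_ \<longleftrightarrow> _ \<in> ?X")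
    proof
      assume "x - t \<in> ?X"
      then have "t + (x - t) \<in> cube t" unfolding cube_def by (rule imageI)
      then show "x \<in> cube t" by simp
    qed (auto simp: cube_def)
    then show ?thesis by (auto simp: algebra_simps)
  qed
  define T where "T = {t. cube t \<in> Q \<and> cube t \<inter> B \<noteq> {}}"
  have "uniform_discrete T"
    unfolding uniform_discrete_def
  proof (intro exI conjI ballI impI)
    fix t u assume tu: "t \<in> T" "u \<in> T" and "dist t u < s"
    have near: "\<bar>t $ i - u $ i\<bar> < s" for i
      using component_le_norm_cart[of "t - u" i] \<open>dist t u < s\<close> by (simp add: dist_norm)
    \<comment> \<open>If two corners are less than \<open>s\<close> apart, their componentwise
      maximum lies in both half-open cubes, so disjointness makes the cubes equal.\<close>
    define x where "x = (\<chi> i. max (t $ i) (u $ i))"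
    have "x \<in> cube t" "x \<in> cube u"
      unfolding cube_iff x_def using near \<open>s > 0\<close> by (auto simp: max_def abs_less_iff; smt (verit))+
    moreover have "disjoint Q"
      using Q by (auto simp: cube_partition_def partition_on_def)
    ultimately have "cube t = cube u"
      using tu by (auto simp: T_def disjoint_def)
    moreover have "t \<in> cube t" "u \<in> cube u"
      using \<open>s > 0\<close> by (auto simp: cube_iff)
    \<comment> \<open>Each corner lies in the cube of the other and is therefore componentwise at
      least as large.\<close>
    ultimately have "t $ i \<le> u $ i \<and> u $ i \<le> t $ i" for i
      using cube_iff by blast
    then show "t = u" by (simp add: vec_eq_iff order_antisym)
  qed (use \<open>s > 0\<close> in auto)
  moreover have "bounded T"
  proof -
    obtain r where r: "\<And>x. x \<in> B \<Longrightarrow> norm x \<le> r"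
      using B by (auto simp: bounded_iff)
    have "norm t \<le> r + real CARD('d) * s" if "t \<in> T" for t
    proof -
      obtain x where x: "x \<in> cube t" "x \<in> B" using \<open>t \<in> T\<close> unfolding T_def by blast
      have "norm (x - t) \<le> (\<Sum>i\<in>UNIV. \<bar>(x - t) $ i\<bar>)"
        by (rule norm_le_l1_cart)
      also have "\<dots> \<le> (\<Sum>i\<in>(UNIV :: 'd set). s)"
        using x(1) by (intro sum_mono) (auto simp: cube_iff abs_le_iff algebra_simps less_imp_le intro: order_trans)
      finally have "norm (x - t) \<le> real CARD('d) * s" by simp
      with r[OF x(2)] norm_triangle_ineq4[of x "x - t"] show ?thesis by simp
    qed
    then show ?thesis by (auto simp: bounded_iff)
  qed
  ultimately have "finite T"
    using uniform_discrete_finite_iff by blast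
  moreover have "{c\<in>Q. c \<inter> B \<noteq> {}} \<subseteq> cube ` T"
  proof
    fix c assume c: "c \<in> {c\<in>Q. c \<inter> B \<noteq> {}}"
    with Q obtain t where "c = cube t"
      unfolding cube_partition_def cube_def by blast
    with c show "c \<in> cube ` T" by (auto simp: T_def)
  qed
  ultimately show ?thesis by (rule finite_surj)
qed

section \<open>Finiteness of the three index sets, and the law for the three random
  variables\<close>

lemma finite_abstract_simplicial_complex:
  "abstract_simplicial_complex V0 K \<Longrightarrow> finite K"
  "abstract_simplicial_complex V0 K \<Longrightarrow> \<sigma> \<in> K \<Longrightarrow> finite \<sigma>"
  by (auto simp: abstract_simplicial_complex_def intro: finite_subset)

text \<open>The realization of the complex is a finite union of convex hulls of finite sets, hence
  bounded.\<close>

lemma finite_voxels: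
  assumes K: "abstract_simplicial_complex V0 K" and "s > 0" "cube_partition s Q"
  shows "finite (voxels K v Q)"
  unfolding voxels_def
proof (rule finite_cubes_meeting_bounded[OF assms(2,3)])
  have "bounded (realization v \<sigma>)" if "\<sigma> \<in> K" for \<sigma>
    unfolding realization_def using finite_abstract_simplicial_complex(2)[OF K that]
    by (intro bounded_convex_hull finite_imp_bounded finite_imageI)
  then show "bounded (\<Union>\<sigma>\<in>K. realization v \<sigma>)"
    using finite_abstract_simplicial_complex(1)[OF K] by (intro bounded_UN) auto
qed

text \<open>All three cases are instances of \<open>bpow_SLLN\<close>, once the index sets are
  finite and the compositions with \<open>X\<close> measurable. The copies are quantified inside
  each conjunct because their types differ.\<close>

theorem theorem5p4:
  fixes V0 :: "'v set" and K :: "'v set set" and v :: "'v \<Rightarrow> real^'d"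
    and ext :: "'v set rel" and alg :: "'v algorithm" and kind :: label_kind
    and A :: "(real^'m) set" and \<psi> :: "real^'m \<Rightarrow> 'v set \<Rightarrow> real"
    and F :: "diagram \<Rightarrow> 'b::{banach, second_countable_topology}"
    and Fh :: "'v labeled_diagram \<Rightarrow> 'v chain \<Rightarrow> 'b"
    and s :: real and Q :: "(real^'d) set set"
    and \<eta>S :: "real^'m \<Rightarrow> 'v chain \<Rightarrow> 'b"
    and \<eta>K :: "real^'m \<Rightarrow> 'v set \<Rightarrow> 'b"
    and \<eta>C :: "real^'m \<Rightarrow> (real^'d) set \<Rightarrow> 'b"
    and M :: "'w measure" and X :: "'w \<Rightarrow> real^'m" and N :: "'u measure"
  assumes complex: "abstract_simplicial_complex V0 K"
    and ext: "linear_extension K ext"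
    and alg: "persistence_algorithm alg"
    and psi: "\<psi> \<in> A \<rightarrow> weights K"
    and decomposition: "labeled_decomposition K (labeled_diagrams K ext alg kind) F Fh"
    and cubes: "s > 0" "cube_partition s Q"
    and \<eta>S_eq: "\<eta>S = Fh \<circ> alpha_hat K ext alg kind A \<psi>"
    and \<eta>K_eq: "\<eta>K = simplex_distribution K Fh \<circ> alpha_hat K ext alg kind A \<psi>"
    and \<eta>C_eq: "\<eta>C = voxel_distribution K v Q Fh \<circ> alpha_hat K ext alg kind A \<psi>"
    and measurable_\<eta>S: "\<eta>S \<in> borel \<rightarrow>\<^sub>M bpow_borel (Pow K)"
    and measurable_\<eta>K: "\<eta>K \<in> borel \<rightarrow>\<^sub>M bpow_borel K"
    and measurable_\<eta>C: "\<eta>C \<in> borel \<rightarrow>\<^sub>M bpow_borel (voxels K v Q)"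
    and prob: "prob_space M" "prob_space N"
    and X: "X \<in> borel_measurable M"
  shows "(\<forall>Vs. independent_copies M (Pow K) (\<eta>S \<circ> X) N Vs \<and>
         (\<integral>\<^sup>+ \<omega>. ennreal (bpow_norm (Pow K) ((\<eta>S \<circ> X) \<omega>)) \<partial>M) < \<infinity> \<longrightarrow>
         (AE \<omega> in N. limitin (bpow_topology (Pow K)) (\<lambda>n. sample_mean (Pow K) Vs n \<omega>)
            (pettis_integral M (Pow K) (\<eta>S \<circ> X)) sequentially)) \<and>
    (\<forall>Vs. independent_copies M K (\<eta>K \<circ> X) N Vs \<and>
         (\<integral>\<^sup>+ \<omega>. ennreal (bpow_norm K ((\<eta>K \<circ> X) \<omega>)) \<partial>M) < \<infinity> \<longrightarrow>
         (AE \<omega> in N. limitin (bpow_topology K) (\<lambda>n. sample_mean K Vs n \<omega>)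
            (pettis_integral M K (\<eta>K \<circ> X)) sequentially)) \<and>
    (\<forall>Vs. independent_copies M (voxels K v Q) (\<eta>C \<circ> X) N Vs \<and>
         (\<integral>\<^sup>+ \<omega>. ennreal (bpow_norm (voxels K v Q) ((\<eta>C \<circ> X) \<omega>)) \<partial>M) < \<infinity> \<longrightarrow>
         (AE \<omega> in N. limitin (bpow_topology (voxels K v Q)) (\<lambda>n. sample_mean (voxels K v Q) Vs n \<omega>)
            (pettis_integral M (voxels K v Q) (\<eta>C \<circ> X)) sequentially))"
proof -
  have fin: "finite (Pow K)" "finite K" "finite (voxels K v Q)"
    using finite_abstract_simplicial_complex(1)[OF complex] finite_voxels[OF complex cubes] by auto
  have "\<eta>S \<circ> X \<in> M \<rightarrow>\<^sub>M bpow_borel (Pow K)" "\<eta>K \<circ> X \<in> M \<rightarrow>\<^sub>M bpow_borel K"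
    "\<eta>C \<circ> X \<in> M \<rightarrow>\<^sub>M bpow_borel (voxels K v Q)"
    using X measurable_\<eta>S measurable_\<eta>K measurable_\<eta>C by (auto intro: measurable_comp)
  then show ?thesis
    using fin prob(2) by (intro conjI allI impI bpow_SLLN) auto
qed

end
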